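(* The variety $\mathcal{N}$ of $6$-dimensional complex nilpotent anticommutative algebras is irreducible of dimension $34$. It contains no rigid algebras, and it equals the Zariski closure of the union $\bigcup_{\alpha\in\mathbb{C}} O(\mathbb{A}_{82}(\alpha))$ of the $\mathrm{GL}_6(\mathbb{C})$-orbits of the following one-parameter family of algebras ($\alpha\in\mathbb{C}$): $$\mathbb{A}_{82}(\alpha):\qquad e_1e_2=e_3,\quad e_1e_3=e_4,\quad e_2e_5=\alpha e_6,\quad e_3e_4=e_5,\quad e_3e_5=e_6,\quad e_4e_5=e_6.$$
   Context: An algebra is a complex vector space with a bilinear product, not assumed associative. It is anticommutative if $xy=-yx$ for all $x,y$. It is nilpotent if $A^k=0$ for some $k$, where $A^1=A$ and $A^{k}=\sum_{i=1}^{k-1}A^iA^{k-i}$. Let $\mathbf{V}=\mathbb{C}^6$ with basis $e_1,\dots,e_6$. An algebra structure $\mu\in\mathrm{Hom}(\mathbf{V}\otimes\mathbf{V},\mathbf{V})$ is identified with the point of $\mathbb{C}^{6^3}$ given by its structure constants $c_{i,j}^k$, where $\mu(e_i\otimes e_j)=\sum_k c_{i,j}^k e_k$. The set $\mathcal{N}\subset\mathbb{C}^{6^3}$ of all nilpotent anticommutative algebra structures on $\mathbf{V}$ is Zariski-closed; it is the variety of $6$-dimensional complex nilpotent anticommutative algebras. The group $\mathrm{GL}_6(\mathbb{C})=\mathrm{GL}(\mathbf{V})$ acts on algebra structures by $(g*\mu)(x\otimes y)=g\mu(g^{-1}x\otimes g^{-1}y)$; the orbits $O(\mu)$ in $\mathcal{N}$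 correspond to isomorphism classes of algebras. An algebra represented by $\mu\in\mathcal{N}$ is called rigid (in $\mathcal{N}$) if $O(\mu)$ is a Zariski-open subset of $\mathcal{N}$, equivalently if $\overline{O(\mu)}$ is an irreducible component of $\mathcal{N}$. In the multiplication table of $\mathbb{A}_{82}(\alpha)$, products of basis elements that are not listed and do not follow from anticommutativity are zero. *)

theory Defs
  imports "HOL-Analysis.Analysis" "HOL-Library.Poly_Mapping"
begin

section \<open>The Zariski topology on complex affine space\<close>

type_synonym 'n cpoly = "('n \<Rightarrow>\<^sub>0 nat) \<Rightarrow>\<^sub>0 complex"

definition monom_eval :: "('n \<Rightarrow>\<^sub>0 nat) \<Rightarrow> complex ^ 'n \<Rightarrow> complex" where
  "monom_eval m x = (\<Prod>i\<in>UNIV. (x $ i) ^ Poly_Mapping.lookup m i)"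

definition cpoly_eval :: "('n::finite) cpoly \<Rightarrow> complex ^ 'n \<Rightarrow> complex" where
  "cpoly_eval p x = (\<Sum>m\<in>Poly_Mapping.keys p. Poly_Mapping.lookup p m * monom_eval m x)"

definition zero_locus :: "('n::finite) cpoly set \<Rightarrow> (complex ^ 'n) set" where
  "zero_locus P = {x. \<forall>p\<in>P. cpoly_eval p x = 0}"

definition zariski :: "(complex ^ 'n::finite) topology" where
  "zariski = topology (\<lambda>U. \<exists>P. U = - zero_locus P)"

text \<open>
  As \<open>topology\<close> is only meaningful for predicates satisfying \<open>istopology\<close>, we check that
  the Zariski closed sets are exactly the zero loci.
\<close>

lemma cpoly_eval_0: "cpoly_eval 0 x = 0"
  by (simp add: cpoly_eval_def)

lemma cpoly_eval_add: "cpoly_eval (p + q) x = cpoly_eval p x + cpoly_eval q x"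
  unfolding cpoly_eval_def by (rule setsum_keys_plus_distrib) (auto simp: algebra_simps)

lemma cpoly_eval_sum: "cpoly_eval (sum f A) x = (\<Sum>a\<in>A. cpoly_eval (f a) x)"
  by (induction A rule: infinite_finite_induct) (auto simp: cpoly_eval_0 cpoly_eval_add)

lemma cpoly_eval_single: "cpoly_eval (Poly_Mapping.single m c) x = c * monom_eval m x"
  by (cases "c = 0") (auto simp: cpoly_eval_def)

lemma monom_eval_0: "monom_eval 0 x = 1"
  by (simp add: monom_eval_def)

lemma monom_eval_add: "monom_eval (m + m') x = monom_eval m x * monom_eval m' x"
  by (simp add: monom_eval_def lookup_add power_add prod.distrib)

lemma cpoly_eval_1: "cpoly_eval 1 x = 1"
  by (simp add: cpoly_eval_single monom_eval_0 flip: single_one)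

lemma cpoly_eval_mult: "cpoly_eval (p * q) x = cpoly_eval p x * cpoly_eval q x"
proof -
  have expand: "(\<Sum>m\<in>Poly_Mapping.keys r. Poly_Mapping.single m (Poly_Mapping.lookup r m)) = r"
    for r :: "'a cpoly"
    by (rule poly_mapping_eqI)
      (simp add: lookup_sum lookup_single when_def not_in_keys_iff_lookup_eq_zero)
  have "cpoly_eval (p * q) x =
      cpoly_eval ((\<Sum>m\<in>Poly_Mapping.keys p. Poly_Mapping.single m (Poly_Mapping.lookup p m)) *
        (\<Sum>m\<in>Poly_Mapping.keys q. Poly_Mapping.single m (Poly_Mapping.lookup q m))) x"
    by (simp only: expand)
  also have "\<dots> = cpoly_eval p x * cpoly_eval q x"
    unfolding sum_product cpoly_eval_sum mult_single cpoly_eval_single monom_eval_add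
    by (simp add: cpoly_eval_def sum_product mult_ac)
  finally show ?thesis .
qed

lemma zero_locus_Un:
  "zero_locus P \<union> zero_locus Q = zero_locus ((\<lambda>(p, q). p * q) ` (P \<times> Q))"
  by (auto simp: zero_locus_def cpoly_eval_mult)

lemma istopology_zariski: "istopology (\<lambda>U. \<exists>P. U = - zero_locus P)"
  unfolding istopology_def
proof (intro conjI allI impI)
  fix S T :: "(complex ^ 'n) set"
  assume "\<exists>P. S = - zero_locus P" "\<exists>P. T = - zero_locus P"
  then obtain P Q where "S = - zero_locus P" "T = - zero_locus Q"
    by blast
  then have "S \<inter> T = - (zero_locus P \<union> zero_locus Q)"
    by blast
  then show "\<exists>P. S \<inter> T = - zero_locus P"
    unfolding zero_locus_Un by blast
next
  fix \<U> :: "(complex ^ 'n) set set"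
  assume "\<forall>U\<in>\<U>. \<exists>P. U = - zero_locus P"
  then obtain P where "\<And>U. U \<in> \<U> \<Longrightarrow> U = - zero_locus (P U)"
    by metis
  then have "\<Union>\<U> = (\<Union>U\<in>\<U>. - zero_locus (P U))"
    by auto
  also have "\<dots> = - zero_locus (\<Union>U\<in>\<U>. P U)"
    by (auto simp: zero_locus_def)
  finally show "\<exists>P. \<Union>\<U> = - zero_locus P"
    by blast
qed

lemma openin_zariski: "openin zariski U \<longleftrightarrow> (\<exists>P. U = - zero_locus P)"
  unfolding zariski_def by (simp add: topology_inverse'[OF istopology_zariski])

lemma topspace_zariski [simp]: "topspace zariski = UNIV"
proof -
  have "openin zariski (UNIV :: (complex ^ 'n) set)"
    unfolding openin_zariski
    by (rule exI[of _ "{1}"]) (auto simp: zero_locus_def cpoly_eval_1)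
  then show ?thesis
    using openin_subset by blast
qed

lemma closedin_zariski: "closedin zariski C \<longleftrightarrow> (\<exists>P. C = zero_locus P)"
  unfolding closedin_def openin_zariski topspace_zariski Compl_eq_Diff_UNIV[symmetric]
  by auto


section \<open>Irreducibility and Krull dimension of topological spaces\<close>

definition irreducible_space :: "'a topology \<Rightarrow> bool" where
  "irreducible_space X \<longleftrightarrow> topspace X \<noteq> {} \<and>
    (\<forall>C D. closedin X C \<longrightarrow> closedin X D \<longrightarrow> C \<union> D = topspace X \<longrightarrow>
      C = topspace X \<or> D = topspace X)"

text \<open>
  The supremum of the lengths \<open>n\<close> of strictly increasing chains
  \<open>Z 0 \<subset> Z 1 \<subset> \<dots> \<subset> Z n\<close> of irreducible closed subsets.
\<close>

definition krull_dimension :: "'a topology \<Rightarrow> enat" where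
  "krull_dimension X = Sup {enat n | n. \<exists>Z :: nat \<Rightarrow> 'a set.
      (\<forall>i\<le>n. closedin X (Z i) \<and> irreducible_space (subtopology X (Z i))) \<and>
      (\<forall>i<n. Z i \<subset> Z (Suc i))}"


section \<open>Algebra structures\<close>

text \<open>
  A point \<open>c\<close> of the affine space with coordinates indexed by triples is the family of
  structure constants of the multiplication \<open>e\<^sub>i e\<^sub>j = (\<Sum>k. c $ (i, j, k) *s e\<^sub>k)\<close>.
\<close>

type_synonym 'n alg_structure = "complex ^ ('n \<times> 'n \<times> 'n)"

definition alg_mult :: "('n::finite) alg_structure \<Rightarrow> complex ^ 'n \<Rightarrow> complex ^ 'n \<Rightarrow> complex ^ 'n" where
  "alg_mult c x y = (\<chi> k. \<Sum>i\<in>UNIV. \<Sum>j\<in>UNIV. c $ (i, j, k) * x $ i * y $ j)"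

definition structure_constants ::
    "(complex ^ 'n \<Rightarrow> complex ^ 'n \<Rightarrow> complex ^ 'n) \<Rightarrow> ('n::finite) alg_structure" where
  "structure_constants \<mu> = (\<chi> t. case t of (i, j, k) \<Rightarrow> \<mu> (axis i 1) (axis j 1) $ k)"

definition anticommutative :: "('n::finite) alg_structure \<Rightarrow> bool" where
  "anticommutative c \<longleftrightarrow> (\<forall>x y. alg_mult c x y = - alg_mult c y x)"

text \<open>
  Here \<open>vec.span\<close> is the span over the complex numbers, whereas \<open>span\<close> would be the span
  over the reals. The value of \<open>alg_power c 0\<close> is irrelevant.
\<close>

definition subspace_mult ::
    "('n::finite) alg_structure \<Rightarrow> (complex ^ 'n) set \<Rightarrow> (complex ^ 'n) set \<Rightarrow> (complex ^ 'n) set" where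
  "subspace_mult c U V = vec.span {alg_mult c x y | x y. x \<in> U \<and> y \<in> V}"

fun alg_power :: "('n::finite) alg_structure \<Rightarrow> nat \<Rightarrow> (complex ^ 'n) set" where
  "alg_power c k = (if k \<le> 1 then UNIV else
    vec.span (\<Union>i\<in>{1..<k}. subspace_mult c (alg_power c i) (alg_power c (k - i))))"

declare alg_power.simps [simp del]

definition nilpotent_alg :: "('n::finite) alg_structure \<Rightarrow> bool" where
  "nilpotent_alg c \<longleftrightarrow> (\<exists>k\<ge>1. alg_power c k = {0})"

definition gl_action :: "complex ^ 'n ^ 'n \<Rightarrow> ('n::finite) alg_structure \<Rightarrow> 'n alg_structure" where
  "gl_action g c = structure_constants
    (\<lambda>x y. g *v alg_mult c (matrix_inv g *v x) (matrix_inv g *v y))"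

definition gl_orbit :: "('n::finite) alg_structure \<Rightarrow> 'n alg_structure set" where
  "gl_orbit c = {gl_action g c | g. invertible g}"

definition nilpotent_anticommutative :: "('n::finite) alg_structure set" where
  "nilpotent_anticommutative = {c. anticommutative c \<and> nilpotent_alg c}"

definition rigid_in :: "('n::finite) alg_structure set \<Rightarrow> 'n alg_structure \<Rightarrow> bool" where
  "rigid_in S c \<longleftrightarrow> c \<in> S \<and> openin (subtopology zariski S) (gl_orbit c)"


section \<open>The family of algebras\<close>

text \<open>
  An entry \<open>((i, j, k), a)\<close> stands for \<open>e\<^sub>i e\<^sub>j = a e\<^sub>k\<close> together with \<open>e\<^sub>j e\<^sub>i = - a e\<^sub>k\<close>.
  The index type \<open>6\<close> consists of \<open>1, \<dots>, 5\<close> and \<open>6 = 0\<close>.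
\<close>

definition anticommutative_table :: "(('n \<times> 'n \<times> 'n) \<times> complex) list \<Rightarrow> ('n::finite) alg_structure" where
  "anticommutative_table ts =
    (\<Sum>((i, j, k), a)\<leftarrow>ts. axis (i, j, k) a - axis (j, i, k) a)"

definition A82 :: "complex \<Rightarrow> 6 alg_structure" where
  "A82 \<alpha> = anticommutative_table
    [((1, 2, 3), 1), ((1, 3, 4), 1), ((2, 5, 6), \<alpha>),
     ((3, 4, 5), 1), ((3, 5, 6), 1), ((4, 5, 6), 1)]"

end

theory Submission
  imports Defs
begin

text \<open>
  Refining the powers of a nilpotent algebra to a full flag shows that the variety \<open>N\<close> is the union
  of the \<open>GL\<close>-translates of the 20-dimensional linear space \<open>T\<close> of triangular structures, those with
  \<open>e\<^sub>i e\<^sub>j\<close> in the span of the \<open>e\<^sub>k\<close> with \<open>k > i, j\<close>. Hence \<open>N\<close> is irreducible: two points are joined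
  by a rational curve.

  A generic element of \<open>T\<close> is brought into the form \<open>A82 \<alpha>\<close> by successive changes of basis, so the
  family is dense. The stabiliser of \<open>A82 \<alpha>\<close> contains a 3-dimensional group, so \<open>N\<close> is the closure
  of the image of a rational map in 34 variables, and the closure of a single orbit that of a
  rational map in 33 variables. A chain of irreducible closed sets of length \<open>n\<close> yields \<open>n\<close>
  algebraically independent functions, whence \<open>n \<le> 34\<close> and \<open>n \<le> 33\<close>, respectively.

  Conversely, a chain of length 34 is obtained from 20 coordinate subspaces of \<open>T\<close> followed by 14
  sets in which the flag is allowed to move in one more direction at a time. Therefore no orbit
  is dense in \<open>N\<close>, whereas an open orbit in an irreducible space would be.
\<close>

section \<open>Rings of functions\<close>

text \<open>The two sides of the dimension count are 36 + 1 - 3 and 20 + 14. The first counts matrix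
  entries and the parameter \<alpha>, less the stabiliser. In the second, 14 is the dimension of a
  partial flag variety: of the 15 strictly triangular matrix entries, the one mixing
  \<open>axis 1 1\<close> and \<open>axis 2 1\<close> preserves \<open>T\<close>, because neither
  vector occurs in a product of a triangular structure. Nilpotency is defined through the powers of
  the algebra, which does not make it visibly a closed condition. It becomes one because, for
  anticommutative structures in dimension 6, it is equivalent to the vanishing of all products
  \<open>x1 (x2 (x3 (x4 (x5 y))))\<close>, whose coordinates are polynomials in the structure
  constants. Exceptional cases, where some denominator vanishes, are not treated by further normal
  forms. The exceptional point is joined to generic ones by a line, and the claim passes to it
  because a nonzero univariate polynomial has only finitely many roots. The ring axioms are isolated
  here since determinants and cleared denominators are needed over several rings of
  functions.\<close>

locale function_ring =
  fixes R :: "('a \<Rightarrow> complex) set"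
  assumes const: "(\<lambda>x. a) \<in> R"
    and add: "f \<in> R \<Longrightarrow> g \<in> R \<Longrightarrow> (\<lambda>x. f x + g x) \<in> R"
    and mult: "f \<in> R \<Longrightarrow> g \<in> R \<Longrightarrow> (\<lambda>x. f x * g x) \<in> R"
begin

lemma sum: "(\<And>i. i \<in> I \<Longrightarrow> f i \<in> R) \<Longrightarrow> (\<lambda>x. \<Sum>i\<in>I. f i x) \<in> R"
  by (induction I rule: infinite_finite_induct) (auto intro: const add)

lemma prod: "(\<And>i. i \<in> I \<Longrightarrow> f i \<in> R) \<Longrightarrow> (\<lambda>x. \<Prod>i\<in>I. f i x) \<in> R"
  by (induction I rule: infinite_finite_induct) (auto intro: const mult)

lemma power: "f \<in> R \<Longrightarrow> (\<lambda>x. f x ^ n) \<in> R"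
  by (induction n) (auto intro: const mult)

lemma det:
  fixes A :: "'a \<Rightarrow> complex ^ 'n ^ 'n"
  assumes "\<And>i j. (\<lambda>x. A x $ i $ j) \<in> R"
  shows "(\<lambda>x. det (A x)) \<in> R"
  unfolding det_def by (intro sum mult const prod assms)

lemma cpoly_eval:
  assumes "\<And>k. (\<lambda>x. \<phi> x $ k) \<in> R"
  shows "(\<lambda>x. cpoly_eval p (\<phi> x)) \<in> R"
  unfolding cpoly_eval_def monom_eval_def by (intro sum mult const prod power assms)

text \<open>A monomial of degree \<open>deg m\<close> in the coordinates of \<open>\<phi>\<close>
  needs the factor \<open>\<delta> ^ deg m\<close>, and a surplus of factors \<delta> stays in the
  ring. The identity is restricted to \<delta> nonzero because \<open>\<phi>\<close> will involve
  \<open>matrix_inv\<close>, which is unspecified at singular matrices.\<close>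

lemma clear_denominator:
  fixes \<phi> :: "'a \<Rightarrow> complex ^ 'n::finite"
  assumes \<delta>: "\<delta> \<in> R"
    and \<phi>: "\<And>k. \<exists>q\<in>R. \<forall>x. \<delta> x \<noteq> 0 \<longrightarrow> \<phi> x $ k * \<delta> x = q x"
  shows "\<exists>N. \<exists>q\<in>R. \<forall>x. \<delta> x \<noteq> 0 \<longrightarrow> cpoly_eval p (\<phi> x) * \<delta> x ^ N = q x"
proof -
  from \<phi> obtain q where q: "\<And>k. q k \<in> R" "\<And>k x. \<delta> x \<noteq> 0 \<Longrightarrow> \<phi> x $ k * \<delta> x = q k x"
    by metis
  define deg where "deg m = (\<Sum>k\<in>UNIV. Poly_Mapping.lookup m k)" for m :: "'n \<Rightarrow>\<^sub>0 nat"
  \<comment> \<open>Any common bound for the degrees would do; the sum avoids a maximum over a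
    possibly empty set.\<close>
  define N where "N = (\<Sum>m\<in>Poly_Mapping.keys p. deg m)"
  define Q where "Q x = (\<Sum>m\<in>Poly_Mapping.keys p. Poly_Mapping.lookup p m *
    ((\<Prod>k\<in>UNIV. q k x ^ Poly_Mapping.lookup m k) * \<delta> x ^ (N - deg m)))" for x
  have "Q \<in> R"
    unfolding Q_def by (intro sum mult const prod power q \<delta>)
  moreover have "cpoly_eval p (\<phi> x) * \<delta> x ^ N = Q x" if "\<delta> x \<noteq> 0" for x
  proof -
    have "monom_eval m (\<phi> x) * \<delta> x ^ N =
        (\<Prod>k\<in>UNIV. q k x ^ Poly_Mapping.lookup m k) * \<delta> x ^ (N - deg m)"
      if m: "m \<in> Poly_Mapping.keys p" for m
    proof -
      have "deg m \<le> N"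
        unfolding N_def by (rule member_le_sum) (use m in auto)
      then have "\<delta> x ^ N = \<delta> x ^ deg m * \<delta> x ^ (N - deg m)"
        by (simp flip: power_add)
      moreover have "monom_eval m (\<phi> x) * \<delta> x ^ deg m = (\<Prod>k\<in>UNIV. q k x ^ Poly_Mapping.lookup m k)"
        unfolding monom_eval_def deg_def
        by (simp add: power_sum power_mult_distrib q(2)[OF \<open>\<delta> x \<noteq> 0\<close>, symmetric]
            flip: prod.distrib)
      ultimately show ?thesis
        by (simp add: mult.assoc [symmetric])
    qed
    then show ?thesis
      unfolding cpoly_eval_def Q_def sum_distrib_right mult.assoc by (intro sum.cong) auto
  qed
  ultimately show ?thesis
    by blast
qed

end

definition polyfuns :: "(complex ^ 'n::finite \<Rightarrow> complex) set" where
  "polyfuns = range cpoly_eval"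

interpretation polyfuns: function_ring "polyfuns :: (complex ^ 'n::finite \<Rightarrow> complex) set"
proof
  fix a :: complex and f g :: "complex ^ 'n \<Rightarrow> complex"
  have "(\<lambda>x. a) = cpoly_eval (Poly_Mapping.single 0 a)"
    by (simp add: fun_eq_iff cpoly_eval_single monom_eval_0)
  then show "(\<lambda>x. a) \<in> polyfuns"
    by (auto simp: polyfuns_def)
  assume "f \<in> polyfuns" "g \<in> polyfuns"
  then obtain p q where "f = cpoly_eval p" "g = cpoly_eval q"
    by (auto simp: polyfuns_def)
  then show "(\<lambda>x. f x + g x) \<in> polyfuns"
    by (auto simp: polyfuns_def fun_eq_iff cpoly_eval_add intro!: image_eqI[of _ _ "p + q"])
  show "(\<lambda>x. f x * g x) \<in> polyfuns"
    using \<open>f = cpoly_eval p\<close> \<open>g = cpoly_eval q\<close>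
    by (auto simp: polyfuns_def fun_eq_iff cpoly_eval_mult intro!: image_eqI[of _ _ "p * q"])
qed

lemma polyfuns_nth: "(\<lambda>x :: complex ^ 'n::finite. x $ i) \<in> polyfuns"
proof -
  have "monom_eval (Poly_Mapping.single i 1) x = x $ i" for x :: "complex ^ 'n"
    by (simp add: monom_eval_def lookup_single when_def if_distrib cong: if_cong)
  then have "(\<lambda>x :: complex ^ 'n. x $ i) = cpoly_eval (Poly_Mapping.single (Poly_Mapping.single i 1) 1)"
    by (simp add: fun_eq_iff cpoly_eval_single)
  then show ?thesis
    by (auto simp: polyfuns_def)
qed

lemma in_range_polyI: "(\<And>s. f s = poly p s) \<Longrightarrow> f \<in> range poly"
  by (rule range_eqI[of _ _ p]) auto

interpretation univariate: function_ring "range poly :: (complex \<Rightarrow> complex) set"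
proof
  fix a :: complex and f g :: "complex \<Rightarrow> complex"
  show "(\<lambda>x. a) \<in> range poly"
    by (rule in_range_polyI[of _ "[:a:]"]) simp
  assume "f \<in> range poly" "g \<in> range poly"
  then obtain p q where "f = poly p" "g = poly q"
    by auto
  then show "(\<lambda>x. f x + g x) \<in> range poly" "(\<lambda>x. f x * g x) \<in> range poly"
    by (auto intro: in_range_polyI[of _ "p + q"] in_range_polyI[of _ "p * q"])
qed

lemma univariate_id: "(\<lambda>s :: complex. s) \<in> range poly"
  by (rule in_range_polyI[of _ "[:0, 1:]"]) simp

lemma univariate_line: "(\<lambda>s :: complex. (1 - s) * a + s * b) \<in> range poly"
  by (rule in_range_polyI[of _ "[:a, b - a:]"]) (simp add: algebra_simps)

section \<open>Zariski closure and irreducibility\<close>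

lemma in_zariski_closure_iff:
  "x \<in> zariski closure_of S \<longleftrightarrow> (\<forall>f\<in>polyfuns. (\<forall>y\<in>S. f y = 0) \<longrightarrow> f x = 0)"
proof
  assume x: "x \<in> zariski closure_of S"
  show "\<forall>f\<in>polyfuns. (\<forall>y\<in>S. f y = 0) \<longrightarrow> f x = 0"
  proof (intro ballI impI)
    fix f :: "complex ^ 'a \<Rightarrow> complex" assume f: "f \<in> polyfuns" "\<forall>y\<in>S. f y = 0"
    then obtain p where p: "f = cpoly_eval p"
      by (auto simp: polyfuns_def)
    have "zariski closure_of S \<subseteq> zero_locus {p}"
      by (rule closure_of_minimal) (use f p in \<open>auto simp: zero_locus_def closedin_zariski\<close>)
    then show "f x = 0"
      using x p by (auto simp: zero_locus_def)
  qed
next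
  assume *: "\<forall>f\<in>polyfuns. (\<forall>y\<in>S. f y = 0) \<longrightarrow> f x = 0"
  obtain P where P: "zariski closure_of S = zero_locus P"
    using closedin_closure_of closedin_zariski by blast
  have "S \<subseteq> zariski closure_of S"
    by (simp add: closure_of_subset)
  then have "cpoly_eval p x = 0" if "p \<in> P" for p
    using that * unfolding P by (auto simp: zero_locus_def polyfuns_def)
  then show "x \<in> zariski closure_of S"
    unfolding P by (auto simp: zero_locus_def)
qed

lemma zariski_closureD:
  assumes "x \<in> zariski closure_of S" "f \<in> polyfuns" "\<And>y. y \<in> S \<Longrightarrow> f y = 0"
  shows "f x = 0"
  using assms by (simp add: in_zariski_closure_iff)

lemma closedin_zariski_if:
  assumes "\<And>x. x \<notin> S \<Longrightarrow> \<exists>f\<in>polyfuns. (\<forall>y\<in>S. f y = 0) \<and> f x \<noteq> 0"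
  shows "closedin zariski S"
proof -
  have "zariski closure_of S \<subseteq> S"
    using assms unfolding subset_iff in_zariski_closure_iff by blast
  then show ?thesis
    by (metis closure_of_subset_eq closure_of_subset topspace_zariski subset_UNIV)
qed

lemma closedin_zariski_zeros:
  assumes "F \<subseteq> polyfuns"
  shows "closedin zariski {x. \<forall>f\<in>F. f x = 0}"
  by (rule closedin_zariski_if) (use assms in auto)

lemma separate_point:
  assumes "closedin zariski S" "x \<notin> S"
  shows "\<exists>f\<in>polyfuns. (\<forall>y\<in>S. f y = 0) \<and> f x \<noteq> 0"
  using assms in_zariski_closure_iff[of x S] closure_of_closedin[OF assms(1)] by blast

text \<open>The polynomial functions vanishing on \<open>S\<close> form a prime ideal. In this form
  irreducibility can be tested on curves and inherited by closures;
  \<open>irreducible_set_iff\<close> links it to the topological notion.\<close>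

definition irreducible_set :: "(complex ^ 'n::finite) set \<Rightarrow> bool" where
  "irreducible_set S \<longleftrightarrow> S \<noteq> {} \<and> (\<forall>f\<in>polyfuns. \<forall>g\<in>polyfuns.
    (\<forall>x\<in>S. f x * g x = 0) \<longrightarrow> (\<forall>x\<in>S. f x = 0) \<or> (\<forall>x\<in>S. g x = 0))"

lemma irreducible_setD:
  assumes "irreducible_set S" "f \<in> polyfuns" "g \<in> polyfuns" "\<And>x. x \<in> S \<Longrightarrow> f x * g x = 0"
  shows "(\<forall>x\<in>S. f x = 0) \<or> (\<forall>x\<in>S. g x = 0)"
  using assms unfolding irreducible_set_def by simp

lemma irreducible_set_iff:
  "irreducible_space (subtopology zariski S) \<longleftrightarrow> irreducible_set S"
proof
  assume L: "irreducible_space (subtopology zariski S)"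
  show "irreducible_set S"
    unfolding irreducible_set_def
  proof (intro conjI ballI impI)
    show "S \<noteq> {}"
      using L by (auto simp: irreducible_space_def)
    fix f g :: "complex ^ 'a \<Rightarrow> complex"
    assume fg: "f \<in> polyfuns" "g \<in> polyfuns" "\<forall>x\<in>S. f x * g x = 0"
    have cl: "closedin (subtopology zariski S) (S \<inter> {x. h x = 0})" if "h \<in> polyfuns" for h
      using closedin_zariski_zeros[of "{h}"] that by (auto simp: closedin_subtopology)
    have "C = S \<or> D = S" if "closedin (subtopology zariski S) C" "closedin (subtopology zariski S) D"
        "C \<union> D = S" for C D
      using L that unfolding irreducible_space_def by simp
    moreover have "(S \<inter> {x. f x = 0}) \<union> (S \<inter> {x. g x = 0}) = S"
      using fg(3) by auto
    ultimately have "S \<inter> {x. f x = 0} = S \<or> S \<inter> {x. g x = 0} = S"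
      using cl[OF fg(1)] cl[OF fg(2)] by blast
    then show "(\<forall>x\<in>S. f x = 0) \<or> (\<forall>x\<in>S. g x = 0)"
      by auto
  qed
next
  assume R: "irreducible_set S"
  show "irreducible_space (subtopology zariski S)"
    unfolding irreducible_space_def
  proof (intro conjI allI impI)
    show "topspace (subtopology zariski S) \<noteq> {}"
      using R by (auto simp: irreducible_set_def)
    fix C D
    assume C: "closedin (subtopology zariski S) C" and D: "closedin (subtopology zariski S) D"
      and CD: "C \<union> D = topspace (subtopology zariski S)"
    obtain C' D' where *: "closedin zariski C'" "C = C' \<inter> S" "closedin zariski D'" "D = D' \<inter> S"
      using C D by (auto simp: closedin_subtopology)
    show "C = topspace (subtopology zariski S) \<or> D = topspace (subtopology zariski S)"
    proof (rule ccontr)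
      assume "\<not> ?thesis"
      then obtain x y where xy: "x \<in> S" "x \<notin> C'" "y \<in> S" "y \<notin> D'"
        using * by auto
      obtain f where f: "f \<in> polyfuns" "\<forall>y\<in>C'. f y = 0" "f x \<noteq> 0"
        using separate_point[OF *(1) xy(2)] by blast
      obtain g where g: "g \<in> polyfuns" "\<forall>y\<in>D'. g y = 0" "g y \<noteq> 0"
        using separate_point[OF *(3) xy(4)] by blast
      have "\<forall>x\<in>S. f x * g x = 0"
        using f g CD * by auto
      then show False
        using R f g xy unfolding irreducible_set_def by blast
    qed
  qed
qed

text \<open>A set and its closure are annihilated by the same polynomial functions.\<close>

lemma irreducible_set_closure:
  assumes "irreducible_set S"
  shows "irreducible_set (zariski closure_of S)"
  unfolding irreducible_set_def
proof (intro conjI ballI impI)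
  have sub: "S \<subseteq> zariski closure_of S"
    by (simp add: closure_of_subset)
  then show "zariski closure_of S \<noteq> {}"
    using assms by (auto simp: irreducible_set_def)
  fix f g :: "complex ^ 'a \<Rightarrow> complex"
  assume fg: "f \<in> polyfuns" "g \<in> polyfuns" "\<forall>x\<in>zariski closure_of S. f x * g x = 0"
  then have "(\<forall>x\<in>S. f x = 0) \<or> (\<forall>x\<in>S. g x = 0)"
    using assms sub unfolding irreducible_set_def by blast
  then show "(\<forall>x\<in>zariski closure_of S. f x = 0) \<or> (\<forall>x\<in>zariski closure_of S. g x = 0)"
    using fg(1,2) by (auto simp: in_zariski_closure_iff)
qed

text \<open>A polynomial function vanishing on \<open>S\<close> restricts to the line as a
  univariate polynomial \<open>P\<close> with \<open>P * Q\<close> zero everywhere. Hence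
  \<open>P = 0\<close>, and the function also vanishes at \<open>s = 0\<close>, even if
  \<open>Q\<close> has a root there. This is how genericity assumptions are removed later.\<close>

lemma line_in_zariski_closed:
  assumes S: "closedin zariski S" and Q: "Q \<noteq> 0"
    and *: "\<And>s. poly Q s \<noteq> 0 \<Longrightarrow> c + s *s d \<in> S"
  shows "c \<in> S"
proof (rule ccontr)
  assume "c \<notin> S"
  then obtain f where f: "f \<in> polyfuns" "\<forall>y\<in>S. f y = 0" "f c \<noteq> 0"
    using separate_point S by blast
  then obtain p where p: "f = cpoly_eval p"
    by (auto simp: polyfuns_def)
  have "(\<lambda>s. f (c + s *s d)) \<in> range poly"
    unfolding p by (rule univariate.cpoly_eval)
      (auto intro!: univariate.add univariate.mult univariate.const univariate_id)
  then obtain P where P: "\<And>s. f (c + s *s d) = poly P s"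
    by (auto simp: fun_eq_iff)
  have "poly (P * Q) s = 0" for s
    using f(2) * P by (cases "poly Q s = 0") (auto simp flip: P)
  then have "P * Q = 0"
    by (simp add: poly_eq_poly_eq_iff[symmetric] fun_eq_iff)
  then have "poly P 0 = 0"
    using Q by simp
  then show False
    using f(3) P[of 0] by simp
qed

section \<open>An upper bound for the Krull dimension\<close>

text \<open>Gaussian elimination: an equation with a nonzero coefficient at \<open>k\<close> is
  solved for the unknown \<open>k\<close> and substituted into the others, which leaves one equation
  and one unknown fewer. An equation without nonzero coefficients is dropped.\<close>

lemma underdetermined_system:
  fixes M :: "'j \<Rightarrow> 'i \<Rightarrow> 'a::field"
  assumes "finite J" "finite I" "card J < card I"
  shows "\<exists>a. (\<exists>i\<in>I. a i \<noteq> 0) \<and> (\<forall>j\<in>J. (\<Sum>i\<in>I. M j i * a i) = 0)"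
  using assms
proof (induction J arbitrary: I M rule: finite_induct)
  case empty
  then show ?case
    by (intro exI[of _ "\<lambda>_. 1"]) (auto simp: card_gt_0_iff)
next
  case (insert j J)
  show ?case
  proof (cases "\<forall>i\<in>I. M j i = 0")
    case True
    have "card J < card I"
      using insert by simp
    from insert.IH[OF insert.prems(1) this, of M] True show ?thesis
      by auto
  next
    case False
    then obtain k where k: "k \<in> I" "M j k \<noteq> 0"
      by auto
    define M' where "M' l i = M l i - M l k * M j i / M j k" for l i
    have "card J < card (I - {k})"
      using insert k by simp
    from insert.IH[OF finite_Diff[OF insert.prems(1)] this, of M'] obtain a where
      a: "\<exists>i\<in>I - {k}. a i \<noteq> 0" "\<forall>l\<in>J. (\<Sum>i\<in>I - {k}. M' l i * a i) = 0"
      by blast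
    define b where "b i = (if i = k then - (\<Sum>i\<in>I - {k}. M j i * a i) / M j k else a i)" for i
    have b: "(\<Sum>i\<in>I. M l i * b i) = (\<Sum>i\<in>I - {k}. M' l i * a i)" for l
    proof -
      have "(\<Sum>i\<in>I. M l i * b i) = M l k * b k + (\<Sum>i\<in>I - {k}. M l i * a i)"
        using k insert.prems(1) by (simp add: sum.remove[of I k] b_def)
      also have "\<dots> = (\<Sum>i\<in>I - {k}. M' l i * a i)"
        unfolding M'_def left_diff_distrib sum_subtractf
        by (simp add: b_def sum_distrib_left sum_divide_distrib mult_ac)
      finally show ?thesis .
    qed
    moreover have "(\<Sum>i\<in>I - {k}. M' j i * a i) = 0"
      using k by (simp add: M'_def)
    ultimately have "\<forall>l\<in>insert j J. (\<Sum>i\<in>I. M l i * b i) = 0"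
      using a by simp
    moreover have "\<exists>i\<in>I. b i \<noteq> 0"
      using a(1) by (auto simp: b_def)
    ultimately show ?thesis
      by blast
  qed
qed

text \<open>Bounding the degree in each variable separately, rather than the total degree, is what a
  vanishing argument on a cubical grid needs. Variables outside \<open>V\<close> are parameters, on
  which the dependence is unrestricted.\<close>

definition separate_degree_le :: "'v set \<Rightarrow> nat \<Rightarrow> (('v \<Rightarrow> complex) \<Rightarrow> complex) \<Rightarrow> bool" where
  "separate_degree_le V d f \<longleftrightarrow>
    (\<forall>v\<in>V. \<forall>x. \<exists>p. degree p \<le> d \<and> (\<forall>s. f (x(v := s)) = poly p s))"

lemma separate_degree_le_const: "separate_degree_le V d (\<lambda>x. a)"
  unfolding separate_degree_le_def by (auto intro!: exI[of _ "[:a:]"])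

lemma separate_degree_le_var:
  assumes "0 < d"
  shows "separate_degree_le V d (\<lambda>x :: 'a \<Rightarrow> complex. x v)"
  unfolding separate_degree_le_def
proof (intro ballI allI)
  fix w and x :: "'a \<Rightarrow> complex"
  show "\<exists>p. degree p \<le> d \<and> (\<forall>s. (x(w := s)) v = poly p s)"
  proof (cases "w = v")
    case True
    then show ?thesis
      using assms by (intro exI[of _ "[:0, 1:] :: complex poly"]) auto
  next
    case False
    then show ?thesis
      by (intro exI[of _ "[:x v:]"]) auto
  qed
qed

lemma separate_degree_le_mono: "separate_degree_le V d f \<Longrightarrow> d \<le> e \<Longrightarrow> separate_degree_le V e f"
  unfolding separate_degree_le_def by (meson le_trans)

lemma separate_degree_le_add:
  assumes "separate_degree_le V d f" "separate_degree_le V d g"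
  shows "separate_degree_le V d (\<lambda>x. f x + g x)"
  unfolding separate_degree_le_def
proof (intro ballI allI)
  fix v x assume "v \<in> V"
  then obtain p q where "degree p \<le> d" "\<And>s. f (x(v := s)) = poly p s"
      "degree q \<le> d" "\<And>s. g (x(v := s)) = poly q s"
    using assms unfolding separate_degree_le_def by metis
  then show "\<exists>p. degree p \<le> d \<and> (\<forall>s. f (x(v := s)) + g (x(v := s)) = poly p s)"
    by (intro exI[of _ "p + q"]) (auto intro: degree_add_le)
qed

lemma separate_degree_le_mult:
  assumes "separate_degree_le V d f" "separate_degree_le V e g"
  shows "separate_degree_le V (d + e) (\<lambda>x. f x * g x)"
  unfolding separate_degree_le_def
proof (intro ballI allI)
  fix v x assume "v \<in> V"
  then obtain p q where "degree p \<le> d" "\<And>s. f (x(v := s)) = poly p s"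
      "degree q \<le> e" "\<And>s. g (x(v := s)) = poly q s"
    using assms unfolding separate_degree_le_def by metis
  then show "\<exists>p. degree p \<le> d + e \<and> (\<forall>s. f (x(v := s)) * g (x(v := s)) = poly p s)"
    by (intro exI[of _ "p * q"]) (auto intro: order.trans[OF degree_mult_le])
qed

lemma separate_degree_le_power:
  "separate_degree_le V d f \<Longrightarrow> separate_degree_le V (n * d) (\<lambda>x. f x ^ n)"
  by (induction n) (auto intro: separate_degree_le_const separate_degree_le_mult)

lemma separate_degree_le_prod:
  "(\<And>i. i \<in> I \<Longrightarrow> separate_degree_le V (d i) (f i)) \<Longrightarrow>
    separate_degree_le V (\<Sum>i\<in>I. d i) (\<lambda>x. \<Prod>i\<in>I. f i x)"
  by (induction I rule: infinite_finite_induct)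
    (auto intro: separate_degree_le_const separate_degree_le_mult)

lemma separate_degree_le_sum:
  "(\<And>i. i \<in> I \<Longrightarrow> separate_degree_le V d (f i)) \<Longrightarrow>
    separate_degree_le V d (\<lambda>x. \<Sum>i\<in>I. f i x)"
  by (induction I rule: infinite_finite_induct)
    (auto intro: separate_degree_le_const separate_degree_le_add)

lemma function_ring_separate_degree: "function_ring {f. \<exists>d. separate_degree_le (V :: 'v set) d f}"
proof
  fix f g :: "('v \<Rightarrow> complex) \<Rightarrow> complex" and a
  show "(\<lambda>x. a) \<in> {f. \<exists>d. separate_degree_le V d f}"
    using separate_degree_le_const by blast
  assume "f \<in> {f. \<exists>d. separate_degree_le V d f}" "g \<in> {f. \<exists>d. separate_degree_le V d f}"
  then obtain d e where de: "separate_degree_le V d f" "separate_degree_le V e g"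
    by auto
  then have "separate_degree_le V (max d e) f" "separate_degree_le V (max d e) g"
    by (auto intro: separate_degree_le_mono)
  then show "(\<lambda>x. f x + g x) \<in> {f. \<exists>d. separate_degree_le V d f}"
    using separate_degree_le_add by blast
  show "(\<lambda>x. f x * g x) \<in> {f. \<exists>d. separate_degree_le V d f}"
    using separate_degree_le_mult[OF de] by blast
qed

text \<open>Induction on the variables: for each of the \<open>d + 1\<close> grid values of
  \<open>w\<close> the function of the remaining variables vanishes, so as a polynomial of degree at
  most \<open>d\<close> in \<open>w\<close> it has too many roots.\<close>

lemma separate_degree_vanishes_on_grid:
  assumes "finite V" "separate_degree_le V d f"
    and "\<And>x. \<lbrakk>\<forall>v\<in>V. x v \<in> of_nat ` {..d}; \<forall>v. v \<notin> V \<longrightarrow> x v = b v\<rbrakk> \<Longrightarrow> f x = 0"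
    and "\<forall>v. v \<notin> V \<longrightarrow> x v = b v"
  shows "f x = 0"
  using assms
proof (induction V arbitrary: b x rule: finite_induct)
  case empty
  then show ?case
    by auto
next
  case (insert w V)
  have V: "separate_degree_le V d f"
    using insert.prems(1) by (auto simp: separate_degree_le_def)
  \<comment> \<open>Here \<open>w\<close> is frozen at a grid value, so the base point changes and
    must be general in the induction.\<close>
  have *: "f y = 0" if "y w \<in> of_nat ` {..d}" "\<forall>v. v \<notin> insert w V \<longrightarrow> y v = b v" for y
  proof (rule insert.IH[OF V, of "b(w := y w)"])
    show "f z = 0" if "\<forall>v\<in>V. z v \<in> of_nat ` {..d}" "\<forall>v. v \<notin> V \<longrightarrow> z v = (b(w := y w)) v" for z
      by (rule insert.prems(2)) (use that insert.hyps \<open>y w \<in> _\<close> in auto)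
    show "\<forall>v. v \<notin> V \<longrightarrow> y v = (b(w := y w)) v"
      using that by auto
  qed
  obtain p where p: "degree p \<le> d" "\<And>s. f (x(w := s)) = poly p s"
    using insert.prems(1) unfolding separate_degree_le_def by blast
  have "p = 0"
  proof (rule ccontr)
    assume "p \<noteq> 0"
    have "of_nat ` {..d} \<subseteq> {s. poly p s = 0}"
      using * insert.prems(3) by (auto simp flip: p(2))
    then have "card (of_nat ` {..d} :: complex set) \<le> card {s. poly p s = 0}"
      by (rule card_mono[OF poly_roots_finite[OF \<open>p \<noteq> 0\<close>]])
    also have "\<dots> \<le> d"
      using card_poly_roots_bound[OF \<open>p \<noteq> 0\<close>] p(1) by simp
    finally show False
      by (simp add: card_image inj_on_def)
  qed
  then show ?case
    using p(2)[of "x w"] by simp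
qed

section \<open>Algebraic independence of the functions separating a chain\<close>

lemma sum_PiE_Suc:
  "(\<Sum>m\<in>{..<Suc n} \<rightarrow>\<^sub>E B. F m) = (\<Sum>k\<in>B. \<Sum>m\<in>{..<n} \<rightarrow>\<^sub>E B. F (m(n := k)))"
proof -
  have "inj_on (\<lambda>(y, g). g(n := y)) (B \<times> ({..<n} \<rightarrow>\<^sub>E B))"
    by (rule inj_combinator) simp
  then show ?thesis
    unfolding lessThan_Suc PiE_insert_eq
    by (simp add: sum.reindex sum.cartesian_product split_def)
qed

text \<open>View the relation as a polynomial in the last function \<open>h n\<close> with
  coefficients \<open>G k\<close>. The lowest power of \<open>h n\<close> cancels, since
  \<open>Z (Suc n)\<close> is irreducible and \<open>h n\<close> is not zero on it. Restricting to
  \<open>Z n\<close>, where \<open>h n\<close> vanishes, leaves only the lowest coefficient, which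
  is a relation between the earlier functions. The coefficients are thus killed in ascending order
  of \<open>k\<close>.\<close>

lemma chain_algebraically_independent:
  fixes h :: "nat \<Rightarrow> complex ^ 'k::finite \<Rightarrow> complex"
  assumes irr: "\<And>i. i \<le> n \<Longrightarrow> irreducible_set (Z i)"
    and sub: "\<And>i. i < n \<Longrightarrow> Z i \<subseteq> Z (Suc i)"
    and h: "\<And>i. i < n \<Longrightarrow> h i \<in> polyfuns"
    and zero: "\<And>i y. i < n \<Longrightarrow> y \<in> Z i \<Longrightarrow> h i y = 0"
    and nonzero: "\<And>i. i < n \<Longrightarrow> \<exists>y\<in>Z (Suc i). h i y \<noteq> 0"
    and rel: "\<And>y. y \<in> Z n \<Longrightarrow> (\<Sum>m\<in>{..<n} \<rightarrow>\<^sub>E {..D}. a m * (\<Prod>i<n. h i y ^ m i)) = 0"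
    and m: "m \<in> {..<n} \<rightarrow>\<^sub>E {..D}"
  shows "a m = 0"
  using assms
proof (induction n arbitrary: a m)
  case 0
  obtain y where "y \<in> Z 0"
    using "0.prems"(1)[of 0] by (auto simp: irreducible_set_def)
  then show ?case
    using "0.prems"(6)[of y] "0.prems"(7) by simp
next
  case (Suc n)
  define G where "G k y = (\<Sum>m\<in>{..<n} \<rightarrow>\<^sub>E {..D}. a (m(n := k)) * (\<Prod>i<n. h i y ^ m i))" for k y
  have G: "G k \<in> polyfuns" for k
    unfolding G_def
    by (intro polyfuns.sum polyfuns.mult polyfuns.const polyfuns.prod polyfuns.power Suc.prems) auto
  have rel: "(\<Sum>k\<le>D. G k y * h n y ^ k) = 0" if "y \<in> Z (Suc n)" for y
  proof -
    have "(\<Prod>i<Suc n. h i y ^ (m(n := k)) i) = (\<Prod>i<n. h i y ^ m i) * h n y ^ k" for m k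
      by simp
    then show ?thesis
      using Suc.prems(6)[OF that] unfolding sum_PiE_Suc G_def sum_distrib_right
      by (simp only: mult.assoc)
  qed
  have "\<forall>m\<in>{..<n} \<rightarrow>\<^sub>E {..D}. a (m(n := k)) = 0" if "k \<le> D" for k
    using that
  proof (induction k rule: less_induct)
    case (less k)
    \<comment> \<open>The terms above \<open>k\<close>, divided by
      \<open>h n ^ Suc k\<close>.\<close>
    define r where "r y = (\<Sum>l\<in>{k<..D}. G l y * h n y ^ (l - Suc k))" for y
    have r: "r \<in> polyfuns"
      unfolding r_def by (intro polyfuns.sum polyfuns.mult polyfuns.power G Suc.prems) auto
    have split: "(\<Sum>l\<le>D. G l y * h n y ^ l) = h n y ^ k * (G k y + h n y * r y)" for y
    proof -
      have "G l y = 0" if "l < k" for l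
      proof -
        have "a (m(n := l)) = 0" if "m \<in> {..<n} \<rightarrow>\<^sub>E {..D}" for m
          using less.IH[OF \<open>l < k\<close>] less.prems \<open>l < k\<close> that by (meson less_or_eq_imp_le order.trans)
        then show ?thesis
          unfolding G_def by (intro sum.neutral ballI) (simp del: fun_upd_apply)
      qed
      then have "(\<Sum>l\<le>D. G l y * h n y ^ l) = (\<Sum>l\<in>insert k {k<..D}. G l y * h n y ^ l)"
        using less.prems by (intro sum.mono_neutral_right) (auto simp: not_le)
      also have "\<dots> = G k y * h n y ^ k + (\<Sum>l\<in>{k<..D}. h n y ^ Suc k * (G l y * h n y ^ (l - Suc k)))"
        by (simp, intro sum.cong) (auto simp flip: power_add power_Suc)
      also have "\<dots> = h n y ^ k * (G k y + h n y * r y)"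
        unfolding r_def sum_distrib_left [symmetric] by (simp add: algebra_simps)
      finally show ?thesis .
    qed
    have poly: "(\<lambda>y. h n y ^ k) \<in> polyfuns" "(\<lambda>y. G k y + h n y * r y) \<in> polyfuns"
      by (intro polyfuns.power polyfuns.add polyfuns.mult G r Suc.prems; simp)+
    have "h n y ^ k * (G k y + h n y * r y) = 0" if "y \<in> Z (Suc n)" for y
      using rel[OF that] by (simp add: split)
    from irreducible_setD[OF Suc.prems(1)[OF order.refl] poly this]
    have "(\<forall>y\<in>Z (Suc n). h n y ^ k = 0) \<or> (\<forall>y\<in>Z (Suc n). G k y + h n y * r y = 0)"
      by simp
    then have "G k y + h n y * r y = 0" if "y \<in> Z (Suc n)" for y
      using Suc.prems(5)[of n] that by auto
    then have Gk: "G k y = 0" if "y \<in> Z n" for y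
      using Suc.prems(2)[of n] Suc.prems(4)[of n y] that by force
    show ?case
    proof
      fix m assume "m \<in> {..<n} \<rightarrow>\<^sub>E {..D}"
      then show "a (m(n := k)) = 0"
        using Suc.IH[where a = "\<lambda>m. a (m(n := k))" and m = m,
            OF Suc.prems(1) Suc.prems(2) Suc.prems(3) Suc.prems(4) Suc.prems(5)]
          Gk[unfolded G_def] by simp
    qed
  qed
  moreover obtain k m' where "k \<in> {..D}" "m' \<in> {..<n} \<rightarrow>\<^sub>E {..D}" "m = m'(n := k)"
    using Suc.prems(7) unfolding lessThan_Suc PiE_insert_eq by auto
  ultimately show ?case
    by (metis atMost_iff)
qed

lemma exists_degree_beating:
  assumes "v < n"
  shows "\<exists>D::nat. (D * C + 1) ^ v < (D + 1) ^ n"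
proof (intro exI)
  \<comment> \<open>With this choice \<open>(C + 1) ^ v\<close> equals \<open>D\<close>, so it costs
    less than one additional factor \<open>D + 1\<close>.\<close>
  define D where "D = (C + 1) ^ v"
  have "(D * C + 1) ^ v \<le> ((C + 1) * (D + 1)) ^ v"
    by (intro power_mono) (auto simp: algebra_simps)
  also have "\<dots> = D * (D + 1) ^ v"
    unfolding power_mult_distrib D_def by simp
  also have "\<dots> < (D + 1) ^ Suc v"
    by simp
  also have "\<dots> \<le> (D + 1) ^ n"
    using assms by (intro power_increasing) auto
  finally show "(D * C + 1) ^ v < (D + 1) ^ n" .
qed

text \<open>
  If the closure of a set with a rational parametrisation by \<open>card V\<close> variables contains a chain
  of length \<open>n\<close>, then the separating functions of the chain pull back to \<open>n\<close> algebraically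
  independent functions. The number \<open>(D + 1) ^ n\<close> of their monomials of degree at most \<open>D\<close> in each
  function is at most the number of points of a grid of size \<open>O(D) ^ card V\<close>, on which the pulled
  back monomials are determined.
\<close>

lemma chain_length_le:
  fixes Z :: "nat \<Rightarrow> (complex ^ 'k::finite) set" and \<phi> :: "('v \<Rightarrow> complex) \<Rightarrow> complex ^ 'k"
  assumes V: "finite V"
    and \<delta>: "\<exists>d. separate_degree_le V d \<delta>"
    and \<phi>: "\<And>k. \<exists>q. (\<exists>d. separate_degree_le V d q) \<and> (\<forall>x. \<delta> x \<noteq> 0 \<longrightarrow> \<phi> x $ k * \<delta> x = q x)"
    and dense: "Z n \<subseteq> zariski closure_of {\<phi> x | x. \<delta> x \<noteq> 0 \<and> (\<forall>v. v \<notin> V \<longrightarrow> x v = b v)}"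
    and irr: "\<And>i. i \<le> n \<Longrightarrow> irreducible_set (Z i)"
    and sub: "\<And>i. i < n \<Longrightarrow> Z i \<subseteq> Z (Suc i)"
    and h: "\<And>i. i < n \<Longrightarrow> h i \<in> polyfuns"
    and zero: "\<And>i y. i < n \<Longrightarrow> y \<in> Z i \<Longrightarrow> h i y = 0"
    and nonzero: "\<And>i. i < n \<Longrightarrow> \<exists>y\<in>Z (Suc i). h i y \<noteq> 0"
  shows "n \<le> card V"
proof (rule ccontr)
  assume "\<not> n \<le> card V"
  interpret R: function_ring "{f. \<exists>d. separate_degree_le V d f}"
    by (rule function_ring_separate_degree)
  obtain e where e: "separate_degree_le V e \<delta>"
    using \<delta> by blast
  have "\<exists>N q d. separate_degree_le V d q \<and> (\<forall>x. \<delta> x \<noteq> 0 \<longrightarrow> h i (\<phi> x) * \<delta> x ^ N = q x)"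
    if i: "i < n" for i
  proof -
    obtain p where p: "h i = cpoly_eval p"
      using h[OF i] by (auto simp: polyfuns_def)
    show ?thesis
      using R.clear_denominator[of \<delta> \<phi> p] \<delta> \<phi> unfolding p by blast
  qed
  then obtain N q d where q: "\<And>i. i < n \<Longrightarrow> separate_degree_le V (d i) (q i)"
      "\<And>i x. i < n \<Longrightarrow> \<delta> x \<noteq> 0 \<Longrightarrow> h i (\<phi> x) * \<delta> x ^ N i = q i x"
    by metis
  \<comment> \<open>Independent of \<open>D\<close>: the products below have degree at most
    \<open>D * C\<close> in each variable, which is linear in \<open>D\<close> and makes the count
    work.\<close>
  define C where "C = (\<Sum>i<n. d i + N i * e)"
  obtain D where D: "(D * C + 1) ^ card V < (D + 1) ^ n"
    using exists_degree_beating \<open>\<not> n \<le> card V\<close> by (meson not_le)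
  define I where "I = {..<n} \<rightarrow>\<^sub>E {..D}"
  define J where "J = V \<rightarrow>\<^sub>E {..D * C}"
  have fin: "finite I" "finite J"
    unfolding I_def J_def using V by (auto intro!: finite_PiE)
  have "card J < card I"
    using D V by (simp add: I_def J_def card_PiE)
  \<comment> \<open>The pulled back monomial with exponents \<open>m\<close>, multiplied by the
    common denominator \<open>\<Prod>i<n. (\<delta> x ^ N i) ^ D\<close>. As this factor does not
    depend on \<open>m\<close>, linear relations are unaffected by it.\<close>
  define \<Phi> where "\<Phi> m x = (\<Prod>i<n. q i x ^ m i * (\<delta> x ^ N i) ^ (D - m i))" for m x
  define point where "point j = (\<lambda>v. if v \<in> V then of_nat (j v) else b v)" for j :: "'v \<Rightarrow> nat"
  \<comment> \<open>One unknown coefficient for each monomial, one equation for each grid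
    point.\<close>
  obtain a where a: "\<exists>m\<in>I. a m \<noteq> 0" "\<forall>j\<in>J. (\<Sum>m\<in>I. \<Phi> m (point j) * a m) = 0"
    using underdetermined_system[OF fin(2,1) \<open>card J < card I\<close>, of "\<lambda>j m. \<Phi> m (point j)"] by blast
  have deg\<Phi>: "separate_degree_le V (D * C) (\<Phi> m)" if "m \<in> I" for m
  proof -
    have "separate_degree_le V (\<Sum>i<n. m i * d i + (D - m i) * (N i * e)) (\<Phi> m)"
      unfolding \<Phi>_def
      by (intro separate_degree_le_prod separate_degree_le_mult separate_degree_le_power q e) auto
    moreover have "(\<Sum>i<n. m i * d i + (D - m i) * (N i * e)) \<le> (\<Sum>i<n. D * (d i + N i * e))"
    proof (intro sum_mono)
      fix i assume "i \<in> {..<n}"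
      then have "m i \<le> D"
        using that by (auto simp: I_def)
      then show "m i * d i + (D - m i) * (N i * e) \<le> D * (d i + N i * e)"
        unfolding distrib_left by (intro add_mono mult_right_mono) auto
    qed
    ultimately show ?thesis
      unfolding C_def sum_distrib_left by (rule separate_degree_le_mono)
  qed
  have "separate_degree_le V (D * C) (\<lambda>x. \<Phi> m x * a m)" if "m \<in> I" for m
    using separate_degree_le_mult[OF deg\<Phi>[OF that] separate_degree_le_const[of V 0 "a m"]]
    by (simp only: add_0_right)
  then have deg: "separate_degree_le V (D * C) (\<lambda>x. \<Sum>m\<in>I. \<Phi> m x * a m)"
    by (rule separate_degree_le_sum[of I V "D * C" "\<lambda>m x. \<Phi> m x * a m"])
  have grid: "(\<Sum>m\<in>I. \<Phi> m y * a m) = 0"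
    if y: "\<forall>v\<in>V. y v \<in> of_nat ` {..D * C}" "\<forall>v. v \<notin> V \<longrightarrow> y v = b v" for y
  proof -
    have "\<forall>v\<in>V. \<exists>k. k \<le> D * C \<and> y v = of_nat k"
      using y(1) by auto
    then obtain j0 where j0: "\<forall>v\<in>V. j0 v \<le> D * C \<and> y v = of_nat (j0 v)"
      using bchoice[of V "\<lambda>v k. k \<le> D * C \<and> y v = of_nat k"] by blast
    have "restrict j0 V \<in> J" "y = point (restrict j0 V)"
      using j0 y by (auto simp: J_def point_def fun_eq_iff)
    then show "(\<Sum>m\<in>I. \<Phi> m y * a m) = 0"
      using a(2) by simp
  qed
  have vanish: "(\<Sum>m\<in>I. \<Phi> m x * a m) = 0" if "\<forall>v. v \<notin> V \<longrightarrow> x v = b v" for x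
    using separate_degree_vanishes_on_grid[of V "D * C" "\<lambda>x. \<Sum>m\<in>I. \<Phi> m x * a m" b x, OF V deg grid that] .
  have rel: "(\<Sum>m\<in>I. a m * (\<Prod>i<n. h i y ^ m i)) = 0" if "y \<in> Z n" for y
  proof -
    define f where "f y = (\<Sum>m\<in>I. a m * (\<Prod>i<n. h i y ^ m i))" for y
    have f: "f \<in> polyfuns"
      unfolding f_def
      by (intro polyfuns.sum polyfuns.mult polyfuns.const polyfuns.prod polyfuns.power h) auto
    have "f (\<phi> x) = 0" if x: "\<delta> x \<noteq> 0" "\<forall>v. v \<notin> V \<longrightarrow> x v = b v" for x
    proof -
      have "\<Phi> m x = (\<Prod>i<n. h i (\<phi> x) ^ m i) * (\<Prod>i<n. (\<delta> x ^ N i) ^ D)" if "m \<in> I" for m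
      proof -
        have "q i x ^ m i * (\<delta> x ^ N i) ^ (D - m i) = h i (\<phi> x) ^ m i * (\<delta> x ^ N i) ^ D"
          if "i < n" for i
        proof -
          have "m i \<le> D"
            using \<open>m \<in> I\<close> that by (auto simp: I_def)
          then have "(\<delta> x ^ N i) ^ D = (\<delta> x ^ N i) ^ m i * (\<delta> x ^ N i) ^ (D - m i)"
            by (simp flip: power_add)
          then show ?thesis
            by (simp add: q(2)[OF \<open>i < n\<close> x(1), symmetric] power_mult_distrib)
        qed
        then show ?thesis
          unfolding \<Phi>_def prod.distrib [symmetric] by (intro prod.cong) auto
      qed
      then have "(\<Sum>m\<in>I. \<Phi> m x * a m) = f (\<phi> x) * (\<Prod>i<n. (\<delta> x ^ N i) ^ D)"
        unfolding f_def sum_distrib_right by (intro sum.cong) auto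
      then show ?thesis
        using vanish[OF x(2)] x(1) by auto
    qed
    then have "f y = 0"
      using dense that f unfolding in_zariski_closure_iff subset_iff by blast
    then show ?thesis
      by (simp add: f_def)
  qed
  obtain m where "m \<in> I" "a m \<noteq> 0"
    using a(1) by blast
  then show False
    using chain_algebraically_independent[OF irr sub h zero nonzero rel[unfolded I_def], of m]
    unfolding I_def by simp
qed

section \<open>The action of the general linear group\<close>

lemma matrix_inv_cancel:
  fixes g :: "'a::field ^ 'n ^ 'n"
  assumes "invertible g"
  shows "g ** matrix_inv g = mat 1" "matrix_inv g ** g = mat 1"
    "g *v (matrix_inv g *v x) = x" "matrix_inv g *v (g *v x) = x"
proof -
  have "g ** matrix_inv g = mat 1 \<and> matrix_inv g ** g = mat 1"
    using assms unfolding invertible_def matrix_inv_def by (rule someI_ex)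
  then show "g ** matrix_inv g = mat 1" "matrix_inv g ** g = mat 1"
    "g *v (matrix_inv g *v x) = x" "matrix_inv g *v (g *v x) = x"
    by (auto simp: matrix_vector_mul_assoc)
qed

lemma invertible_matrix_inv: "invertible g \<Longrightarrow> invertible (matrix_inv g)"
  for g :: "'a::field ^ 'n ^ 'n"
  unfolding invertible_def using matrix_inv_cancel(1,2)[of g] unfolding invertible_def by blast

lemma invertibleI:
  fixes g :: "'a::field ^ 'n ^ 'n"
  assumes "\<And>x. g *v x = 0 \<Longrightarrow> x = 0"
  shows "invertible g"
  using assms by (simp add: invertible_left_inverse matrix_left_invertible_injective vec.inj_iff_eq_0)

lemma mult_axis_nth: "(g *v axis i 1) $ k = g $ k $ i" for g :: "'a::field ^ 'n ^ 'm"
  by (simp add: matrix_vector_mult_def axis_def if_distrib cong: if_cong)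

text \<open>Cramer's rule with the denominator cleared: the right-hand side is polynomial in the
  entries of \<open>g\<close>.\<close>

lemma matrix_inv_nth:
  fixes g :: "'a::field ^ 'n ^ 'n"
  assumes "det g \<noteq> 0"
  shows "matrix_inv g $ a $ i * det g = det (\<chi> r s. if s = a then axis i 1 $ r else g $ r $ s)"
proof -
  have "g *v (matrix_inv g *v axis i 1) = axis i 1"
    using assms by (simp add: matrix_inv_cancel invertible_det_nz)
  then have "matrix_inv g *v axis i 1 =
      (\<chi> k. det (\<chi> r s. if s = k then axis i 1 $ r else g $ r $ s) / det g)"
    using cramer[OF assms] by blast
  then have "matrix_inv g $ a $ i =
      det (\<chi> r s. if s = a then axis i 1 $ r else g $ r $ s) / det g"
    by (metis (no_types, lifting) mult_axis_nth vec_lambda_beta)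
  then show ?thesis
    using assms by simp
qed

section \<open>Multiplications given by structure constants, and change of basis\<close>

lemma linearI_vec:
  fixes f :: "'a::field ^ 'n \<Rightarrow> 'a ^ 'm"
  assumes "\<And>x y. f (x + y) = f x + f y" "\<And>a x. f (a *s x) = a *s f x"
  shows "Vector_Spaces.linear (*s) (*s) f"
  using assms by (simp add: Vector_Spaces.linear_iff vec.vector_space_axioms)

lemma linear_expand:
  fixes f :: "'a::field ^ 'n \<Rightarrow> 'a ^ 'm"
  assumes "Vector_Spaces.linear (*s) (*s) f"
  shows "f x $ k = (\<Sum>i\<in>UNIV. f (axis i 1) $ k * x $ i)"
  using matrix_works[OF assms, of x] by (simp add: matrix_vector_mult_def matrix_def vec_eq_iff)

lemma alg_mult_add_left: "alg_mult c (x + x') y = alg_mult c x y + alg_mult c x' y"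
  by (simp add: vec_eq_iff alg_mult_def algebra_simps sum.distrib)

lemma alg_mult_add_right: "alg_mult c x (y + y') = alg_mult c x y + alg_mult c x y'"
  by (simp add: vec_eq_iff alg_mult_def algebra_simps sum.distrib)

lemma alg_mult_scale_left: "alg_mult c (a *s x) y = a *s alg_mult c x y"
  by (simp add: vec_eq_iff alg_mult_def sum_distrib_left mult_ac)

lemma alg_mult_scale_right: "alg_mult c x (a *s y) = a *s alg_mult c x y"
  by (simp add: vec_eq_iff alg_mult_def sum_distrib_left mult_ac)

lemma alg_mult_0_right: "alg_mult c x 0 = 0"
  by (simp add: vec_eq_iff alg_mult_def)

lemma alg_mult_structure_constants:
  assumes "\<And>y. Vector_Spaces.linear (*s) (*s) (\<lambda>x. \<mu> x y)"
    and "\<And>x. Vector_Spaces.linear (*s) (*s) (\<mu> x)"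
  shows "alg_mult (structure_constants \<mu>) x y = \<mu> x y"
proof (subst vec_eq_iff, intro allI)
  fix k
  have 1: "\<mu> x y $ k = (\<Sum>i\<in>UNIV. \<mu> (axis i 1) y $ k * x $ i)"
    by (rule linear_expand[OF assms(1)])
  have 2: "\<mu> (axis i 1) y $ k = (\<Sum>j\<in>UNIV. \<mu> (axis i 1) (axis j 1) $ k * y $ j)" for i
    by (rule linear_expand[OF assms(2)])
  have "\<mu> x y $ k = (\<Sum>i\<in>UNIV. (\<Sum>j\<in>UNIV. \<mu> (axis i 1) (axis j 1) $ k * y $ j) * x $ i)"
    unfolding 1 2 ..
  then show "alg_mult (structure_constants \<mu>) x y $ k = \<mu> x y $ k"
    by (simp add: alg_mult_def structure_constants_def sum_distrib_left sum_distrib_right mult_ac)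
qed

lemma alg_mult_axis: "alg_mult c (axis i 1) (axis j 1) $ k = c $ (i, j, k)"
proof -
  have "alg_mult c (axis i 1) (axis j 1) $ k =
      (\<Sum>a\<in>UNIV. if a = i then (\<Sum>b\<in>UNIV. if b = j then c $ (a, b, k) else 0) else 0)"
    unfolding alg_mult_def vec_lambda_beta by (intro sum.cong refl) (simp add: axis_def if_distrib [of "(*) _"] cong: if_cong)
  then show ?thesis
    by simp
qed

lemma structure_eqI:
  assumes "\<And>i j. alg_mult c (axis i 1) (axis j 1) = alg_mult d (axis i 1) (axis j 1)"
  shows "c = d"
proof (subst vec_eq_iff, intro allI)
  fix t
  show "c $ t = d $ t"
    by (cases t) (metis assms alg_mult_axis)
qed

lemma anticommutative_iff: "anticommutative c \<longleftrightarrow> (\<forall>i j k. c $ (i, j, k) = - c $ (j, i, k))"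
proof
  assume "anticommutative c"
  then show "\<forall>i j k. c $ (i, j, k) = - c $ (j, i, k)"
    unfolding anticommutative_def by (metis alg_mult_axis vector_uminus_component)
next
  assume *: "\<forall>i j k. c $ (i, j, k) = - c $ (j, i, k)"
  have "alg_mult c x y $ k = - alg_mult c y x $ k" for x y k
  proof -
    have "(\<Sum>i\<in>UNIV. \<Sum>j\<in>UNIV. c $ (i, j, k) * x $ i * y $ j) =
        (\<Sum>i\<in>UNIV. \<Sum>j\<in>UNIV. - (c $ (j, i, k) * y $ j * x $ i))"
      by (intro sum.cong refl) (subst *[rule_format], simp)
    also have "\<dots> = - (\<Sum>j\<in>UNIV. \<Sum>i\<in>UNIV. c $ (j, i, k) * y $ j * x $ i)"
      by (subst sum.swap) (simp add: sum_negf)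
    finally show ?thesis
      by (simp add: alg_mult_def)
  qed
  then show "anticommutative c"
    unfolding anticommutative_def vec_eq_iff vector_uminus_component by blast
qed

lemma alg_mult_gl_action:
  "alg_mult (gl_action g c) x y = g *v alg_mult c (matrix_inv g *v x) (matrix_inv g *v y)"
  unfolding gl_action_def
  by (rule alg_mult_structure_constants; rule linearI_vec)
    (simp_all add: matrix_vector_right_distrib alg_mult_add_left alg_mult_add_right
      vec.scale alg_mult_scale_left alg_mult_scale_right)

lemma alg_mult_gl_action':
  assumes "invertible g"
  shows "alg_mult (gl_action g c) (g *v x) (g *v y) = g *v alg_mult c x y"
  by (simp add: alg_mult_gl_action matrix_inv_cancel assms)

text \<open>Pulling \<open>d\<close> back along \<open>g\<close> turns the hypothesis into an
  equality of structure constants with \<open>c\<close>. Isomorphisms can thus be verified on basis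
  vectors without computing an inverse.\<close>

lemma gl_action_eqI:
  assumes "invertible g"
    and "\<And>i j. alg_mult d (g *v axis i 1) (g *v axis j 1) = g *v alg_mult c (axis i 1) (axis j 1)"
  shows "gl_action g c = d"
proof -
  have *: "alg_mult (gl_action (matrix_inv g) d) x y = matrix_inv g *v alg_mult d (g *v x) (g *v y)" for x y
    using alg_mult_gl_action'[OF invertible_matrix_inv[OF assms(1)], of d "g *v x" "g *v y"]
    by (simp add: matrix_inv_cancel assms(1))
  have "gl_action (matrix_inv g) d = c"
    by (rule structure_eqI) (simp add: * assms matrix_inv_cancel)
  then have "alg_mult c x y = matrix_inv g *v alg_mult d (g *v x) (g *v y)" for x y
    using * by simp
  then show ?thesis
    by (intro structure_eqI) (simp add: alg_mult_gl_action matrix_inv_cancel assms(1))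
qed

lemma gl_action_gl_action:
  assumes "invertible g" "invertible h"
  shows "gl_action g (gl_action h c) = gl_action (g ** h) c"
  by (rule gl_action_eqI[symmetric])
    (simp_all add: assms invertible_mult alg_mult_gl_action' flip: matrix_vector_mul_assoc)

lemma invertible_mat_1: "invertible (mat 1 :: 'a::field ^ 'n ^ 'n)"
  by (rule invertibleI) simp

lemma gl_action_1: "gl_action (mat 1) c = c"
  by (rule gl_action_eqI) (simp_all add: invertible_mat_1)

lemma gl_orbit_trans:
  assumes "d \<in> gl_orbit c" "e \<in> gl_orbit d"
  shows "e \<in> gl_orbit c"
  using assms unfolding gl_orbit_def by (force simp: gl_action_gl_action intro: invertible_mult)

lemma gl_orbit_sym:
  assumes "d \<in> gl_orbit c"
  shows "c \<in> gl_orbit d"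
proof -
  obtain g where g: "invertible g" "d = gl_action g c"
    using assms by (auto simp: gl_orbit_def)
  then have "c = gl_action (matrix_inv g) d"
    by (simp add: gl_action_gl_action invertible_matrix_inv matrix_inv_cancel gl_action_1)
  then show ?thesis
    using g invertible_matrix_inv by (auto simp: gl_orbit_def)
qed

lemma gl_orbit_refl: "c \<in> gl_orbit c"
  unfolding gl_orbit_def using invertible_mat_1 gl_action_1 by (metis (mono_tags, lifting) mem_Collect_eq)

lemma gl_action_nth:
  "gl_action g c $ (i, j, k) = (\<Sum>l\<in>UNIV. g $ k $ l *
    (\<Sum>a\<in>UNIV. \<Sum>b\<in>UNIV. c $ (a, b, l) * matrix_inv g $ a $ i * matrix_inv g $ b $ j))"
  by (simp add: gl_action_def structure_constants_def matrix_vector_mult_def [of g] alg_mult_def mult_axis_nth)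

text \<open>The inverse matrix enters twice, once for each argument of the product; hence the square
  of the determinant.\<close>

lemma (in function_ring) gl_action_rational:
  assumes "\<And>i j. (\<lambda>x. G x $ i $ j) \<in> R" "\<And>t. (\<lambda>x. C x $ t) \<in> R"
  shows "\<exists>q\<in>R. \<forall>x. (det (G x))\<^sup>2 \<noteq> 0 \<longrightarrow> gl_action (G x) (C x) $ t * (det (G x))\<^sup>2 = q x"
proof -
  obtain i j k where t: "t = (i, j, k)"
    by (cases t)
  define A where "A a i x = det (\<chi> r s. if s = a then axis i 1 $ r else G x $ r $ s)" for a i x
  define q where "q x = (\<Sum>l\<in>UNIV. G x $ k $ l *
    (\<Sum>a\<in>UNIV. \<Sum>b\<in>UNIV. C x $ (a, b, l) * A a i x * A b j x))" for x
  have "A a i \<in> R" for a i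
    unfolding A_def
  proof (rule det)
    fix r s
    show "(\<lambda>x. (\<chi> r s. if s = a then axis i 1 $ r else G x $ r $ s) $ r $ s) \<in> R"
      using assms(1) const by (cases "s = a") auto
  qed
  then have "q \<in> R"
    unfolding q_def by (intro sum mult assms)
  moreover have "gl_action (G x) (C x) $ t * (det (G x))\<^sup>2 = q x" if "det (G x) \<noteq> 0" for x
    unfolding t gl_action_nth q_def A_def matrix_inv_nth[OF that, symmetric]
    by (simp add: sum_distrib_left sum_distrib_right power2_eq_square mult_ac)
  ultimately show ?thesis
    by auto
qed

section \<open>Rational curves of transformed structures\<close>

definition matrix_line :: "complex ^ 'n ^ 'n \<Rightarrow> complex ^ 'n ^ 'n \<Rightarrow> complex \<Rightarrow> complex ^ 'n ^ 'n" where
  "matrix_line g h s = (\<chi> i j. (1 - s) * g $ i $ j + s * h $ i $ j)"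

lemma matrix_line_ends: "matrix_line g h 0 = g" "matrix_line g h 1 = h"
  by (simp_all add: matrix_line_def vec_eq_iff)

lemma pullback_along_line:
  assumes "f \<in> polyfuns"
  shows "\<exists>N p. \<forall>s. det (matrix_line g h s) \<noteq> 0 \<longrightarrow>
    f (gl_action (matrix_line g h s) ((1 - s) *s c + s *s d)) * (det (matrix_line g h s))\<^sup>2 ^ N = poly p s"
proof -
  have G: "(\<lambda>s. matrix_line g h s $ i $ j) \<in> range poly" for i j
    using univariate_line by (simp add: matrix_line_def)
  have C: "(\<lambda>s. ((1 - s) *s c + s *s d) $ t) \<in> range poly" for t
    using univariate_line by (simp only: vector_add_component vector_smult_component)
  obtain p where p: "f = cpoly_eval p"
    using assms by (auto simp: polyfuns_def)
  have "(\<lambda>s. (det (matrix_line g h s))\<^sup>2) \<in> range poly"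
    by (intro univariate.power univariate.det G)
  from univariate.clear_denominator[OF this univariate.gl_action_rational[OF G C], of p]
  show ?thesis
    unfolding p by (auto simp: image_iff)
qed

lemma univariate_det_line: "\<exists>p. \<forall>s. det (matrix_line g h s) = poly p s"
proof -
  have "(\<lambda>s. det (matrix_line g h s)) \<in> range poly"
    by (rule univariate.det) (use univariate_line in \<open>simp add: matrix_line_def\<close>)
  then show ?thesis
    by (auto simp: fun_eq_iff)
qed

definition translates ::
    "(complex ^ 'n ^ 'n) set \<Rightarrow> ('n::finite) alg_structure set \<Rightarrow> 'n alg_structure set" where
  "translates M L = {gl_action g c | g c. g \<in> M \<and> invertible g \<and> c \<in> L}"

text \<open>If \<open>f1\<close> is nonzero at one translate and \<open>f2\<close> at another, move
  the matrix and the structure along lines simultaneously. Up to powers of the determinant both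
  functions become nonzero univariate polynomials, so both are nonzero at a common parameter.
  Stability of \<open>M\<close> and \<open>L\<close> under lines is a condition that the whole
  variety and the cells of the later chain share.\<close>

lemma irreducible_translates:
  assumes ne: "c0 \<in> L" "g0 \<in> M" "invertible g0"
    and M: "\<And>g h s. g \<in> M \<Longrightarrow> h \<in> M \<Longrightarrow> matrix_line g h s \<in> M"
    and L: "\<And>c d s. c \<in> L \<Longrightarrow> d \<in> L \<Longrightarrow> (1 - s) *s c + s *s d \<in> L"
  shows "irreducible_set (translates M L)"
  unfolding irreducible_set_def
proof (intro conjI ballI impI)
  show "translates M L \<noteq> {}"
    using ne by (auto simp: translates_def)
  fix f1 f2 :: "'a alg_structure \<Rightarrow> complex"
  assume f: "f1 \<in> polyfuns" "f2 \<in> polyfuns" and zero: "\<forall>x\<in>translates M L. f1 x * f2 x = 0"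
  show "(\<forall>x\<in>translates M L. f1 x = 0) \<or> (\<forall>x\<in>translates M L. f2 x = 0)"
  proof (rule ccontr)
    assume "\<not> ?thesis"
    then obtain g c h d where
      gc: "g \<in> M" "invertible g" "c \<in> L" "f1 (gl_action g c) \<noteq> 0" and
      hd: "h \<in> M" "invertible h" "d \<in> L" "f2 (gl_action h d) \<noteq> 0"
      by (fastforce simp: translates_def)
    define \<gamma> where "\<gamma> s = gl_action (matrix_line g h s) ((1 - s) *s c + s *s d)" for s
    obtain N1 p1 where p1: "\<And>s. det (matrix_line g h s) \<noteq> 0 \<Longrightarrow>
        f1 (\<gamma> s) * (det (matrix_line g h s))\<^sup>2 ^ N1 = poly p1 s"
      unfolding \<gamma>_def using pullback_along_line[OF f(1)] by blast
    obtain N2 p2 where p2: "\<And>s. det (matrix_line g h s) \<noteq> 0 \<Longrightarrow>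
        f2 (\<gamma> s) * (det (matrix_line g h s))\<^sup>2 ^ N2 = poly p2 s"
      unfolding \<gamma>_def using pullback_along_line[OF f(2)] by blast
    obtain p where p: "\<And>s. det (matrix_line g h s) = poly p s"
      using univariate_det_line by blast
    have "\<gamma> 0 = gl_action g c" "\<gamma> 1 = gl_action h d"
      by (simp_all add: \<gamma>_def matrix_line_ends)
    then have "poly p1 0 \<noteq> 0" "poly p2 1 \<noteq> 0" "poly p 0 \<noteq> 0"
      using gc hd p1[of 0] p2[of 1] p[of 0] by (auto simp: matrix_line_ends invertible_det_nz)
    \<comment> \<open>The determinant \<open>p\<close> is included since the line may pass through
      singular matrices.\<close>
    then have "p1 * p2 * p \<noteq> 0"
      by auto
    then obtain s where "poly (p1 * p2 * p) s \<noteq> 0"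
      using poly_all_0_iff_0 by blast
    then have s: "poly p1 s \<noteq> 0" "poly p2 s \<noteq> 0" "poly p s \<noteq> 0"
      by auto
    then have "f1 (\<gamma> s) * f2 (\<gamma> s) \<noteq> 0"
      using p1[of s] p2[of s] p[of s] by auto
    moreover have "invertible (matrix_line g h s)"
      using s(3) p[of s] by (simp add: invertible_det_nz)
    then have "\<gamma> s \<in> translates M L"
      unfolding translates_def \<gamma>_def using M[OF gc(1) hd(1)] L[OF gc(3) hd(3)] by blast
    ultimately show False
      using zero by blast
  qed
qed

text \<open>The analogue of \<open>line_in_zariski_closed\<close> for the group: \<open>g\<close> is
  the endpoint \<open>s = 1\<close> of a line starting at the identity, and it may itself be a root
  of \<open>Q\<close>.\<close>

lemma gl_curve_in_closed:
  assumes S: "closedin zariski S" and g: "invertible g" and Q: "Q \<noteq> 0"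
    and *: "\<And>s. poly Q s \<noteq> 0 \<Longrightarrow> invertible (matrix_line (mat 1) g s) \<Longrightarrow>
      gl_action (matrix_line (mat 1) g s) c \<in> S"
  shows "gl_action g c \<in> S"
proof (rule ccontr)
  assume "gl_action g c \<notin> S"
  then obtain f where f: "f \<in> polyfuns" "\<forall>y\<in>S. f y = 0" "f (gl_action g c) \<noteq> 0"
    using separate_point[OF S] by blast
  let ?G = "matrix_line (mat 1) g"
  have c: "(1 - s) *s c + s *s c = c" for s
    by (simp add: vec_eq_iff algebra_simps)
  obtain N q where q: "\<And>s. det (?G s) \<noteq> 0 \<Longrightarrow> f (gl_action (?G s) c) * (det (?G s))\<^sup>2 ^ N = poly q s"
    using pullback_along_line[OF f(1), of "mat 1" g c c] unfolding c by blast
  obtain p where p: "\<And>s. det (?G s) = poly p s"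
    using univariate_det_line by blast
  have "poly (Q * p * q) s = 0" for s
  proof (rule ccontr)
    assume "poly (Q * p * q) s \<noteq> 0"
    then have s: "poly Q s \<noteq> 0" "poly p s \<noteq> 0" "poly q s \<noteq> 0"
      by auto
    have "invertible (?G s)"
      using s(2) by (simp add: invertible_det_nz p)
    with s(1) have "gl_action (?G s) c \<in> S"
      by (rule *)
    then have "f (gl_action (?G s) c) = 0"
      using f(2) by simp
    then show False
      using q[of s] s p[of s] by auto
  qed
  then have "Q * p * q = 0"
    using poly_all_0_iff_0 by blast
  moreover have "poly p 1 \<noteq> 0" "poly q 1 \<noteq> 0"
    using g p[of 1] q[of 1] f(3) by (auto simp: matrix_line_ends invertible_det_nz)
  ultimately show False
    using Q by auto
qed

text \<open>For a fixed \<open>g\<close> the action is linear in the structure constants, so it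
  pulls polynomial functions back to polynomial functions.\<close>

lemma gl_action_closure:
  assumes U: "\<And>g c. invertible g \<Longrightarrow> c \<in> U \<Longrightarrow> gl_action g c \<in> U"
    and g: "invertible g" and c: "c \<in> zariski closure_of U"
  shows "gl_action g c \<in> zariski closure_of U"
  unfolding in_zariski_closure_iff
proof (intro ballI impI)
  fix f :: "'a alg_structure \<Rightarrow> complex"
  assume f: "f \<in> polyfuns" "\<forall>y\<in>U. f y = 0"
  have coord: "(\<lambda>c. gl_action g c $ t) \<in> polyfuns" for t
    by (cases t) (simp only: gl_action_nth, intro polyfuns.sum polyfuns.mult polyfuns.const polyfuns_nth)
  obtain p where p: "f = cpoly_eval p"
    using f by (auto simp: polyfuns_def)
  have "(\<lambda>c. f (gl_action g c)) \<in> polyfuns"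
    unfolding p by (rule polyfuns.cpoly_eval[OF coord])
  moreover have "\<forall>y\<in>U. f (gl_action g y) = 0"
    using f(2) U[OF g] by blast
  ultimately show "f (gl_action g c) = 0"
    using zariski_closureD[OF c, of "\<lambda>c. f (gl_action g c)"] by blast
qed

section \<open>Nilpotency and triangular structures\<close>

lemma anticommutative_gl_action: "anticommutative c \<Longrightarrow> anticommutative (gl_action g c)"
  unfolding anticommutative_def alg_mult_gl_action
  by (metis vec.neg)

lemma foldr_alg_mult_gl_action:
  assumes "invertible g"
  shows "foldr (alg_mult (gl_action g c)) xs y =
    g *v foldr (alg_mult c) (map ((*v) (matrix_inv g)) xs) (matrix_inv g *v y)"
  by (induction xs) (simp_all add: matrix_inv_cancel assms alg_mult_gl_action)

lemma polyfuns_foldr_alg_mult: "(\<lambda>c. foldr (alg_mult c) xs y $ k) \<in> polyfuns"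
proof (induction xs arbitrary: k)
  case Nil
  then show ?case
    by (simp add: polyfuns.const)
next
  case (Cons x xs)
  then show ?case
    by (simp add: alg_mult_def) (intro polyfuns.sum polyfuns.mult polyfuns.const polyfuns_nth Cons)
qed

text \<open>The subspaces \<open>Q m\<close> filter the algebra, and a product with one factor in
  \<open>Q m\<close> lies in \<open>Q (Suc m)\<close>. In a product of the powers \<open>i\<close>
  and \<open>k - i\<close> with \<open>k\<close> at least \<open>2 ^ Suc l\<close>, one of the two
  exponents is at least \<open>2 ^ l\<close>. Hence the power \<open>2 ^ m\<close> of the algebra
  lies in \<open>Q m\<close>.\<close>

lemma nilpotent_if_left_nilpotent:
  assumes c: "anticommutative c"
    and words: "\<And>xs y. length xs = n \<Longrightarrow> foldr (alg_mult c) xs y = 0"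
  shows "nilpotent_alg c"
proof -
  \<comment> \<open>The vectors killed by every word of at least \<open>n - m\<close> left
    multiplications: everything for \<open>m = 0\<close>, only zero for
    \<open>m = n\<close>.\<close>
  define Q where "Q m = {v. \<forall>xs. n \<le> length xs + m \<longrightarrow> foldr (alg_mult c) xs v = 0}" for m
  have foldr_lin: "foldr (alg_mult c) xs 0 = 0"
    "foldr (alg_mult c) xs (u + v) = foldr (alg_mult c) xs u + foldr (alg_mult c) xs v"
    "foldr (alg_mult c) xs (a *s u) = a *s foldr (alg_mult c) xs u" for xs u v a
    by (induction xs) (simp_all add: alg_mult_0_right alg_mult_add_right alg_mult_scale_right)
  have sub: "vec.subspace (Q m)" for m
    by (rule vec.subspaceI) (auto simp: Q_def foldr_lin)
  have Q0: "v \<in> Q 0" for v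
  proof -
    have "foldr (alg_mult c) xs v = 0" if "n \<le> length xs" for xs
    proof -
      have "foldr (alg_mult c) xs v =
          foldr (alg_mult c) (take n xs) (foldr (alg_mult c) (drop n xs) v)"
        by (metis append_take_drop_id comp_apply foldr_append)
      then show ?thesis
        using words that by simp
    qed
    then show ?thesis
      by (simp add: Q_def)
  qed
  have right: "alg_mult c x v \<in> Q (Suc m)" if "v \<in> Q m" for x v m
    unfolding Q_def
  proof (intro CollectI allI impI)
    fix xs :: "(complex ^ 'a) list" assume "n \<le> length xs + Suc m"
    moreover have "\<forall>xs. n \<le> length xs + m \<longrightarrow> foldr (alg_mult c) xs v = 0"
      using that by (simp add: Q_def)
    ultimately have "foldr (alg_mult c) (xs @ [x]) v = 0"
      by (elim allE[of _ "xs @ [x]"]) simp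
    then show "foldr (alg_mult c) xs (alg_mult c x v) = 0"
      by simp
  qed
  have left: "alg_mult c v x \<in> Q (Suc m)" if "v \<in> Q m" for x v m
    using vec.subspace_neg[OF sub right[OF that]] c unfolding anticommutative_def by metis
  have "alg_power c k \<subseteq> Q m" if "2 ^ m \<le> k" for k m
    using that
  proof (induction k arbitrary: m rule: less_induct)
    case (less k)
    show ?case
    proof (cases m)
      case 0
      then show ?thesis
        using Q0 by auto
    next
      case (Suc l)
      then have "2 ^ l + 2 ^ l \<le> k" "1 \<le> (2 :: nat) ^ l"
        using less.prems by auto
      then have k: "\<not> k \<le> 1"
        by linarith
      have "alg_mult c x y \<in> Q m" if i: "i \<in> {1..<k}" and x: "x \<in> alg_power c i"
        and y: "y \<in> alg_power c (k - i)" for i x y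
      proof (cases "2 ^ l \<le> i")
        case True
        then have "x \<in> Q l"
          using less.IH[of i l] i x by auto
        then show ?thesis
          using left Suc by simp
      next
        case False
        then have "2 ^ l \<le> k - i"
          using \<open>2 ^ l + 2 ^ l \<le> k\<close> by linarith
        then have "y \<in> Q l"
          using less.IH[of "k - i" l] i y by auto
        then show ?thesis
          using right Suc by simp
      qed
      then have "subspace_mult c (alg_power c i) (alg_power c (k - i)) \<subseteq> Q m" if "i \<in> {1..<k}" for i
        unfolding subspace_mult_def using that by (intro vec.span_minimal sub) auto
      then have "(\<Union>i\<in>{1..<k}. subspace_mult c (alg_power c i) (alg_power c (k - i))) \<subseteq> Q m"
        by (intro UN_least)
      from vec.span_minimal[OF this sub] show ?thesis
        using alg_power.simps[of c k] k by simp
    qed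
  qed
  then have "alg_power c (2 ^ n) \<subseteq> Q n"
    by blast
  also have "Q n \<subseteq> {0}"
    by (auto simp: Q_def dest: spec [of _ "[]"])
  finally have "alg_power c (2 ^ n) \<subseteq> {0}" .
  moreover have "0 \<in> alg_power c (2 ^ n)"
    by (subst alg_power.simps) (simp add: vec.span_zero)
  ultimately show ?thesis
    unfolding nilpotent_alg_def by (intro exI[of _ "2 ^ n"]) auto
qed

section \<open>Flags adapted to a nilpotent multiplication\<close>

lemma alg_power_Suc:
  assumes "1 \<le> k" "v \<in> alg_power c k"
  shows "alg_mult c x v \<in> alg_power c (Suc k)"
proof -
  have "alg_mult c x v \<in> subspace_mult c (alg_power c 1) (alg_power c (Suc k - 1))"
    unfolding subspace_mult_def
    by (rule vec.span_base) (use assms in \<open>auto simp: alg_power.simps[of c "Suc 0"]\<close>)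
  then show ?thesis
    unfolding alg_power.simps[of c "Suc k"] using assms(1) by (force intro!: vec.span_base)
qed

text \<open>Take \<open>v\<close> outside \<open>W\<close> in the last power of the algebra that is
  not contained in \<open>W\<close>; multiplication by any \<open>x\<close> sends it to the next
  power.\<close>

lemma nilpotent_extend:
  assumes "nilpotent_alg c" "W \<noteq> UNIV" "0 \<in> W"
  shows "\<exists>v. v \<notin> W \<and> (\<forall>x. alg_mult c x v \<in> W)"
proof -
  obtain k0 where "k0 \<ge> 1" "alg_power c k0 = {0}"
    using assms by (auto simp: nilpotent_alg_def)
  then have ex: "\<exists>k. 1 \<le> k \<and> alg_power c k \<subseteq> W"
    using assms(3) by (intro exI[of _ k0]) auto
  define k where "k = (LEAST k. 1 \<le> k \<and> alg_power c k \<subseteq> W)"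
  have k: "1 \<le> k" "alg_power c k \<subseteq> W"
    unfolding k_def using LeastI_ex[OF ex] by auto
  have "alg_power c 1 = UNIV"
    by (simp add: alg_power.simps)
  then have "k \<noteq> 1"
    using k assms(2) by auto
  then have "1 \<le> k - 1" "k - 1 < k"
    using k by auto
  then have "\<not> alg_power c (k - 1) \<subseteq> W"
    using not_less_Least[of "k - 1" "\<lambda>k. 1 \<le> k \<and> alg_power c k \<subseteq> W"] unfolding k_def by auto
  then obtain v where v: "v \<in> alg_power c (k - 1)" "v \<notin> W"
    by auto
  then have "alg_mult c x v \<in> W" for x
    using alg_power_Suc[OF \<open>1 \<le> k - 1\<close> v(1), of x] k by auto
  then show ?thesis
    using v by blast
qed

text \<open>The flag grows from the annihilator upwards, one vector from
  \<open>nilpotent_extend\<close> at a time. Only the right factor is controlled; anticommutativity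
  will supply the left one.\<close>

lemma nilpotent_flag:
  fixes c :: "('n::finite) alg_structure"
  assumes "nilpotent_alg c" "m \<le> CARD('n)"
  shows "\<exists>b :: nat \<Rightarrow> complex ^ 'n. vec.independent (b ` {..<m}) \<and> inj_on b {..<m} \<and>
    (\<forall>i<m. \<forall>x. alg_mult c x (b i) \<in> vec.span (b ` {..<i}))"
  using assms(2)
proof (induction m)
  case 0
  then show ?case
    by (simp add: vec.independent_empty)
next
  case (Suc m)
  then obtain b :: "nat \<Rightarrow> complex ^ 'n" where b: "vec.independent (b ` {..<m})" "inj_on b {..<m}"
    "\<And>i x. i < m \<Longrightarrow> alg_mult c x (b i) \<in> vec.span (b ` {..<i})"
    by auto
  have "vec.span (b ` {..<m}) \<noteq> UNIV"
  proof
    assume "vec.span (b ` {..<m}) = UNIV"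
    then have "vec.dim (UNIV :: (complex ^ 'n) set) = card (b ` {..<m})"
      using b(1) by (metis vec.dim_span_eq_card_independent)
    then show False
      using b(2) Suc.prems by (simp add: card_image card_cart_basis)
  qed
  then obtain v where v: "v \<notin> vec.span (b ` {..<m})" "\<And>x. alg_mult c x v \<in> vec.span (b ` {..<m})"
    using nilpotent_extend[OF assms(1), of "vec.span (b ` {..<m})"] vec.span_zero by blast
  define b' where "b' = b(m := v)"
  have im: "b' ` {..<i} = b ` {..<i}" if "i \<le> m" for i
    using that by (auto simp: b'_def)
  have new: "b' ` {..<Suc m} = insert v (b ` {..<m})"
    using im[of m] by (simp add: lessThan_Suc) (simp add: b'_def)
  have "v \<notin> b ` {..<m}"
    using v(1) vec.span_base[of v "b ` {..<m}"] by blast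
  moreover have "inj_on b' {..<m}"
    using b(2) inj_on_cong[of "{..<m}" b' b] by (simp add: b'_def)
  moreover have "b' m = v" "{..<m} - {m} = {..<m}"
    by (auto simp: b'_def)
  ultimately have "inj_on b' {..<Suc m}"
    using im[of m] by (simp add: lessThan_Suc)
  moreover have "vec.independent (b' ` {..<Suc m})"
    unfolding new using b(1) v(1) \<open>v \<notin> b ` {..<m}\<close> by (simp add: vec.independent_insert)
  moreover have "alg_mult c x (b' i) \<in> vec.span (b' ` {..<i})" if "i < Suc m" for i x
  proof (cases "i = m")
    case True
    then show ?thesis
      using v(2) by (simp add: im) (simp add: b'_def)
  next
    case False
    then show ?thesis
      using b(3) that by (simp add: im) (simp add: b'_def)
  qed
  ultimately show ?case
    by blast
qed

text \<open>The rank function orders the basis explicitly; in the index type used below,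
  \<open>6 = 0\<close>.\<close>

definition triangular :: "('n \<Rightarrow> nat) \<Rightarrow> ('n::finite) alg_structure set" where
  "triangular r = {c. anticommutative c \<and> (\<forall>i j k. c $ (i, j, k) \<noteq> 0 \<longrightarrow> r i < r k \<and> r j < r k)}"

lemma nilpotent_anticommutative_triangularizable:
  fixes c :: "('n::finite) alg_structure"
  assumes c: "nilpotent_alg c" "anticommutative c" and r: "bij_betw r UNIV {1..CARD('n)}"
  shows "\<exists>g d. invertible g \<and> d \<in> triangular r \<and> c = gl_action g d"
proof -
  let ?n = "CARD('n)"
  \<comment> \<open>The flag begins with vectors annihilated by left multiplications, whereas rank
    is to increase under products. So the basis vector of rank \<open>r i\<close> takes position
    \<open>CARD('n) - r i\<close>.\<close>
  define p where "p i = ?n - r i" for i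
  have rn: "1 \<le> r i" "r i \<le> ?n" for i
    using r by (auto simp: bij_betw_def)
  have inj_r: "r i = r j \<longleftrightarrow> i = j" for i j
    using r by (auto simp: bij_betw_def inj_on_def)
  have p: "inj p" "p i < ?n" for i
    using rn inj_r unfolding inj_on_def p_def by (metis diff_diff_cancel, metis diff_less less_le_trans zero_less_one)
  obtain b :: "nat \<Rightarrow> complex ^ 'n" where b: "vec.independent (b ` {..<?n})" "inj_on b {..<?n}"
    "\<And>i x. i < ?n \<Longrightarrow> alg_mult c x (b i) \<in> vec.span (b ` {..<i})"
    using nilpotent_flag[OF c(1), of ?n] by auto
  define g :: "complex ^ 'n ^ 'n" where "g = (\<chi> i j. b (p j) $ i)"
  have g_axis: "g *v axis j 1 = b (p j)" for j
    by (simp add: vec_eq_iff mult_axis_nth g_def)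
  have g_mult: "g *v x = (\<Sum>j\<in>UNIV. x $ j *s b (p j))" for x
    by (simp add: vec_eq_iff matrix_vector_mult_def g_def mult.commute)
  have inj_bp: "inj (\<lambda>j. b (p j))"
    using p b(2) by (auto simp: inj_on_def)
  have g: "invertible g"
  proof (rule invertibleI)
    fix x assume "g *v x = 0"
    define u where "u v = x $ inv (\<lambda>j. b (p j)) v" for v
    have "(\<Sum>v\<in>range (\<lambda>j. b (p j)). u v *s v) = 0"
      using \<open>g *v x = 0\<close> inv_f_f[OF inj_bp] by (simp add: sum.reindex[OF inj_bp] g_mult u_def)
    moreover have "range (\<lambda>j. b (p j)) \<subseteq> b ` {..<?n}"
      using p by auto
    ultimately have "u (b (p j)) = 0" for j
      using vec.independentD[OF b(1), of "range (\<lambda>j. b (p j))" u "b (p j)"] by simp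
    then show "x = 0"
      using inv_f_f[OF inj_bp] by (simp add: vec_eq_iff u_def)
  qed
  \<comment> \<open>In the new basis, the first \<open>m\<close> flag vectors have zero coordinates
    at all indices with position \<open>m\<close> or later.\<close>
  have span: "(matrix_inv g *v w) $ k = 0" if w: "w \<in> vec.span (b ` {..<m})" and m: "m \<le> p k" for w m k
  proof -
    have "b ` {..<m} \<subseteq> {w. (matrix_inv g *v w) $ k = 0}"
    proof safe
      fix q assume "q < m"
      have "p ` UNIV = {..<?n}"
        using p by (intro card_subset_eq) (auto simp: card_image)
      then obtain j where j: "q = p j"
        using \<open>q < m\<close> m p(2)[of k] by (metis imageE lessThan_iff less_le_trans order.strict_trans)
      then have "j \<noteq> k"
        using \<open>q < m\<close> m by auto
      moreover have "matrix_inv g *v b q = axis j 1"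
        unfolding j g_axis [symmetric] by (simp add: matrix_inv_cancel g)
      ultimately show "(matrix_inv g *v b q) $ k = 0"
        by (simp add: axis_def)
    qed
    moreover have "vec.subspace {w. (matrix_inv g *v w) $ k = 0}"
      by (rule vec.subspaceI) (simp_all add: matrix_vector_right_distrib vec.scale)
    ultimately have "vec.span (b ` {..<m}) \<subseteq> {w. (matrix_inv g *v w) $ k = 0}"
      by (rule vec.span_minimal)
    then show ?thesis
      using w by auto
  qed
  define d where "d = gl_action (matrix_inv g) c"
  have anti: "anticommutative d"
    unfolding d_def by (rule anticommutative_gl_action[OF c(2)])
  have d: "r j < r k" if "d $ (i, j, k) \<noteq> 0" for i j k
  proof -
    have "matrix_inv g *v alg_mult c (b (p i)) (b (p j)) = alg_mult d (axis i 1) (axis j 1)"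
      unfolding d_def using alg_mult_gl_action'[OF invertible_matrix_inv[OF g], of c "b (p i)" "b (p j)"]
      unfolding g_axis [symmetric] by (simp add: matrix_inv_cancel g)
    then have "(matrix_inv g *v alg_mult c (b (p i)) (b (p j))) $ k \<noteq> 0"
      using that by (simp add: alg_mult_axis)
    then have "\<not> p j \<le> p k"
      using span b(3)[OF p(2)] by blast
    then show ?thesis
      unfolding p_def by simp
  qed
  have "d \<in> triangular r"
    unfolding triangular_def
  proof (intro CollectI conjI allI impI anti)
    fix i j k assume ne: "d $ (i, j, k) \<noteq> 0"
    then have "d $ (j, i, k) \<noteq> 0"
      using anti unfolding anticommutative_iff by (metis neg_equal_0_iff_equal)
    then show "r i < r k" "r j < r k"
      using d ne by auto
  qed
  moreover have "c = gl_action g d"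
    unfolding d_def by (simp add: gl_action_gl_action g invertible_matrix_inv matrix_inv_cancel gl_action_1)
  ultimately show ?thesis
    using g by blast
qed

text \<open>
  The first product already lies in the span of the basis vectors of rank at least 3,
  because \<open>e\<^sub>i e\<^sub>i = 0\<close>.
\<close>

lemma foldr_triangular:
  assumes c: "c \<in> triangular r" and r: "inj r" "\<And>i. 1 \<le> r i"
    and xs: "xs \<noteq> []" and k: "foldr (alg_mult c) xs y $ k \<noteq> 0"
  shows "length xs + 1 < r k"
  using xs k
proof (induction xs arbitrary: k)
  case Nil
  then show ?case
    by simp
next
  case (Cons x xs)
  let ?z = "foldr (alg_mult c) xs y"
  have "\<exists>i j. c $ (i, j, k) * x $ i * ?z $ j \<noteq> 0"
    using Cons.prems(2)
    by (auto simp: alg_mult_def [of c x ?z] elim!: sum.not_neutral_contains_not_neutral) blast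
  then obtain i j where ij: "c $ (i, j, k) \<noteq> 0" "?z $ j \<noteq> 0"
    by auto
  have lt: "r i < r k" "r j < r k"
    using c ij(1) by (auto simp: triangular_def)
  show ?case
  proof (cases "xs = []")
    case True
    have "i \<noteq> j"
    proof
      assume "i = j"
      then have "c $ (i, j, k) = - c $ (i, j, k)"
        using c unfolding triangular_def anticommutative_iff by blast
      then show False
        using ij(1) by simp
    qed
    then have "r i \<noteq> r j"
      using r(1) by (auto simp: inj_on_def)
    then show ?thesis
      using True lt r(2)[of i] r(2)[of j] by simp
  next
    case False
    then show ?thesis
      using Cons.IH[OF _ ij(2)] lt by simp
  qed
qed

text \<open>Both claims follow from a circle of inclusions through a set \<open>W\<close> defined by
  polynomial equations.\<close>

lemma nilpotent_anticommutative_eq: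
  assumes r: "bij_betw r (UNIV :: 'n set) {1..CARD('n)}" and n: "2 \<le> CARD('n)"
  shows "(nilpotent_anticommutative :: ('n::finite) alg_structure set) = translates UNIV (triangular r)"
    and "closedin zariski (nilpotent_anticommutative :: 'n alg_structure set)"
proof -
  let ?n = "CARD('n)"
  let ?N = "nilpotent_anticommutative :: 'n alg_structure set"
  \<comment> \<open>By \<open>foldr_triangular\<close>, a nonzero coordinate of a word of length
    \<open>?n - 1\<close> would have rank greater than \<open>?n\<close>. The bound
    \<open>2 \<le> CARD('n)\<close> makes such words nonempty.\<close>
  define W where "W = {c :: 'n alg_structure. anticommutative c \<and>
    (\<forall>xs y. length xs = ?n - 1 \<longrightarrow> foldr (alg_mult c) xs y = 0)}"
  have closed: "closedin zariski W"
  proof (rule closedin_zariski_if)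
    fix c assume "c \<notin> W"
    then consider i j k where "c $ (i, j, k) + c $ (j, i, k) \<noteq> 0"
      | xs y k where "length xs = ?n - 1" "foldr (alg_mult c) xs y $ k \<noteq> 0"
      unfolding W_def mem_Collect_eq anticommutative_iff eq_neg_iff_add_eq_0 vec_eq_iff
        zero_index by blast
    then show "\<exists>f\<in>polyfuns. (\<forall>y\<in>W. f y = 0) \<and> f c \<noteq> 0"
    proof cases
      case 1
      have "\<forall>d\<in>W. d $ (i, j, k) + d $ (j, i, k) = 0"
        unfolding W_def mem_Collect_eq anticommutative_iff eq_neg_iff_add_eq_0 by blast
      with 1 show ?thesis
        by (intro bexI[of _ "\<lambda>d. d $ (i, j, k) + d $ (j, i, k)"] polyfuns.add polyfuns_nth) auto
    next
      case 2
      then have "\<forall>d\<in>W. foldr (alg_mult d) xs y $ k = 0"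
        by (simp add: W_def)
      with 2 show ?thesis
        by (intro bexI[of _ "\<lambda>d. foldr (alg_mult d) xs y $ k"] polyfuns_foldr_alg_mult) auto
    qed
  qed
  have 1: "?N \<subseteq> translates UNIV (triangular r)"
    using nilpotent_anticommutative_triangularizable[OF _ _ r]
    unfolding nilpotent_anticommutative_def translates_def by blast
  have 2: "translates UNIV (triangular r) \<subseteq> W"
  proof
    fix c assume "c \<in> translates UNIV (triangular r)"
    then obtain g d where c: "c = gl_action g d" "invertible g" "d \<in> triangular r"
      by (auto simp: translates_def)
    have r': "inj r" "\<And>i. 1 \<le> r i" "\<And>i. r i \<le> ?n"
      using r by (auto simp: bij_betw_def)
    have "foldr (alg_mult c) xs y = 0" if "length xs = ?n - 1" for xs y
    proof -
      have "foldr (alg_mult d) (map ((*v) (matrix_inv g)) xs) (matrix_inv g *v y) $ k = 0" for k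
        using foldr_triangular[OF c(3) r'(1,2), of "map ((*v) (matrix_inv g)) xs" "matrix_inv g *v y" k]
          r'(3)[of k] that n by fastforce
      then show ?thesis
        by (simp add: c foldr_alg_mult_gl_action vec_eq_iff matrix_vector_mult_def)
    qed
    moreover have "anticommutative c"
      using c by (auto simp: triangular_def intro: anticommutative_gl_action)
    ultimately show "c \<in> W"
      unfolding W_def by blast
  qed
  have 3: "W \<subseteq> ?N"
    using nilpotent_if_left_nilpotent[of _ "?n - 1"] unfolding W_def subset_iff nilpotent_anticommutative_def
    by blast
  show "?N = translates UNIV (triangular r)"
    using 1 2 3 by blast
  show "closedin zariski ?N"
    using closed 1 2 3 by (metis subset_antisym order.trans)
qed

section \<open>Structures in dimension 6\<close>

lemma UNIV_6: "(UNIV :: 6 set) = {1, 2, 3, 4, 5, 6}"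
proof -
  have "x \<in> {1, 2, 3, 4, 5, 6}" for x :: 6
  proof (induct x)
    case (of_int z)
    then have "z = 0 \<or> z = 1 \<or> z = 2 \<or> z = 3 \<or> z = 4 \<or> z = 5"
      by fastforce
    then show ?case
      by auto
  qed
  then show ?thesis
    by auto
qed

lemma forall_6: "(\<forall>i :: 6. P i) \<longleftrightarrow> P 1 \<and> P 2 \<and> P 3 \<and> P 4 \<and> P 5 \<and> P 6"
  using UNIV_6 by (metis (no_types, lifting) UNIV_I insert_iff empty_iff)

lemma sum_6: "sum f (UNIV :: 6 set) = f 1 + f 2 + f 3 + f 4 + f 5 + f 6"
  unfolding UNIV_6 by (simp add: add.assoc)


definition vec6 :: "complex \<Rightarrow> complex \<Rightarrow> complex \<Rightarrow> complex \<Rightarrow> complex \<Rightarrow> complex \<Rightarrow> complex ^ 6" where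
  "vec6 a b c d e f = (\<chi> i. if i = 1 then a else if i = 2 then b else if i = 3 then c
    else if i = 4 then d else if i = 5 then e else f)"

lemma vec6_nth [simp]:
  "vec6 a b c d e f $ 1 = a" "vec6 a b c d e f $ 2 = b" "vec6 a b c d e f $ 3 = c"
  "vec6 a b c d e f $ 4 = d" "vec6 a b c d e f $ 5 = e" "vec6 a b c d e f $ 6 = f"
  by (simp_all add: vec6_def)

lemma vec6_eqI:
  "\<lbrakk>x $ 1 = y $ 1; x $ 2 = y $ 2; x $ 3 = y $ 3; x $ 4 = y $ 4; x $ 5 = y $ 5; x $ 6 = y $ 6\<rbrakk>
    \<Longrightarrow> x = (y :: complex ^ 6)"
  by (simp add: vec_eq_iff forall_6)

lemma axis_6:
  "axis 1 1 = vec6 1 0 0 0 0 0" "axis 2 1 = vec6 0 1 0 0 0 0" "axis 3 1 = vec6 0 0 1 0 0 0"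
  "axis 4 1 = vec6 0 0 0 1 0 0" "axis 5 1 = vec6 0 0 0 0 1 0" "axis 6 1 = vec6 0 0 0 0 0 1"
  by (simp_all add: vec_eq_iff forall_6 axis_def)

definition rank6 :: "6 \<Rightarrow> nat" where
  "rank6 i = (if i = 1 then 1 else if i = 2 then 2 else if i = 3 then 3
    else if i = 4 then 4 else if i = 5 then 5 else 6)"

lemma rank6_simps [simp]:
  "rank6 1 = 1" "rank6 2 = 2" "rank6 3 = 3" "rank6 4 = 4" "rank6 5 = 5" "rank6 6 = 6"
  by (simp_all add: rank6_def)

lemma bij_rank6: "bij_betw rank6 UNIV {1..CARD(6)}"
proof -
  have "{1..CARD(6)} = {1, 2, 3, 4, 5, 6}"
    by auto
  then show ?thesis
    unfolding UNIV_6 by (simp add: bij_betw_def)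
qed

section \<open>Triangular structures in coordinates\<close>

lemma triangular_anti: "c \<in> triangular r \<Longrightarrow> c $ (i, j, k) = - c $ (j, i, k)"
  unfolding triangular_def anticommutative_iff by blast

lemma triangular_zero: "c \<in> triangular r \<Longrightarrow> r k \<le> r i \<or> r k \<le> r j \<Longrightarrow> c $ (i, j, k) = 0"
  unfolding triangular_def by (metis (mono_tags, lifting) leD mem_Collect_eq)

lemma triangular_diag: "c \<in> triangular r \<Longrightarrow> c $ (i, i, k) = 0"
  using triangular_anti[of c r i i k] by simp

abbreviation minor :: "complex ^ 'n \<Rightarrow> complex ^ 'n \<Rightarrow> 'n \<Rightarrow> 'n \<Rightarrow> complex" where
  "minor x y i j \<equiv> x $ i * y $ j - x $ j * y $ i"

text \<open>Exactly the 20 constants with increasing indices \<open>i\<close>, \<open>j\<close>,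
  \<open>k\<close> are free. Each multiplies a 2 by 2 minor of the two arguments, by
  anticommutativity.\<close>

lemma alg_mult_triangular:
  assumes c: "c \<in> triangular rank6"
  shows "alg_mult c x y = vec6 0 0 (c $ (1, 2, 3) * minor x y 1 2)
    (c $ (1, 2, 4) * minor x y 1 2 + c $ (1, 3, 4) * minor x y 1 3 + c $ (2, 3, 4) * minor x y 2 3)
    (c $ (1, 2, 5) * minor x y 1 2 + c $ (1, 3, 5) * minor x y 1 3 + c $ (2, 3, 5) * minor x y 2 3
      + c $ (1, 4, 5) * minor x y 1 4 + c $ (2, 4, 5) * minor x y 2 4 + c $ (3, 4, 5) * minor x y 3 4)
    (c $ (1, 2, 6) * minor x y 1 2 + c $ (1, 3, 6) * minor x y 1 3 + c $ (2, 3, 6) * minor x y 2 3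
      + c $ (1, 4, 6) * minor x y 1 4 + c $ (2, 4, 6) * minor x y 2 4 + c $ (3, 4, 6) * minor x y 3 4
      + c $ (1, 5, 6) * minor x y 1 5 + c $ (2, 5, 6) * minor x y 2 5 + c $ (3, 5, 6) * minor x y 3 5
      + c $ (4, 5, 6) * minor x y 4 5)"
proof -
  have anti: "c $ (2, 1, k) = - c $ (1, 2, k)" "c $ (3, 1, k) = - c $ (1, 3, k)"
    "c $ (4, 1, k) = - c $ (1, 4, k)" "c $ (5, 1, k) = - c $ (1, 5, k)"
    "c $ (3, 2, k) = - c $ (2, 3, k)" "c $ (4, 2, k) = - c $ (2, 4, k)"
    "c $ (5, 2, k) = - c $ (2, 5, k)" "c $ (4, 3, k) = - c $ (3, 4, k)"
    "c $ (5, 3, k) = - c $ (3, 5, k)" "c $ (5, 4, k) = - c $ (4, 5, k)" for k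
    by (rule triangular_anti[OF c])+
  show ?thesis
    by (rule vec6_eqI)
      (simp_all add: alg_mult_def sum_6 anti triangular_zero[OF c] triangular_diag[OF c] algebra_simps)
qed

lemma triangularI_6:
  assumes "\<And>x y. alg_mult c x y = vec6 0 0 (c123 * minor x y 1 2)
    (c124 * minor x y 1 2 + c134 * minor x y 1 3 + c234 * minor x y 2 3)
    (c125 * minor x y 1 2 + c135 * minor x y 1 3 + c235 * minor x y 2 3
      + c145 * minor x y 1 4 + c245 * minor x y 2 4 + c345 * minor x y 3 4)
    (c126 * minor x y 1 2 + c136 * minor x y 1 3 + c236 * minor x y 2 3
      + c146 * minor x y 1 4 + c246 * minor x y 2 4 + c346 * minor x y 3 4
      + c156 * minor x y 1 5 + c256 * minor x y 2 5 + c356 * minor x y 3 5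
      + c456 * minor x y 4 5)"
  shows "c \<in> triangular rank6"
proof -
  have "anticommutative c"
    unfolding anticommutative_def assms by (intro allI vec6_eqI) (simp_all add: algebra_simps)
  moreover have "\<forall>i j k. c $ (i, j, k) \<noteq> 0 \<longrightarrow> rank6 i < rank6 k \<and> rank6 j < rank6 k"
    unfolding forall_6 alg_mult_axis [symmetric] assms axis_6 by simp
  ultimately show ?thesis
    by (simp add: triangular_def)
qed

text \<open>What remains of the table when \<open>e3 = e1 e2\<close>, \<open>e4 = e1 e3\<close>,
  \<open>e5 = e3 e4\<close>, \<open>e6 = e3 e5\<close> and \<open>e2 e3\<close> has no component at
  \<open>e4\<close>. The parameters are read from \<open>e2 e3 = a e5 + b e6\<close>,
  \<open>e1 e4 = c e5 + d e6\<close>, \<open>e2 e4 = p e5 + q e6\<close>,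
  \<open>e1 e5 = e e6\<close>, \<open>e2 e5 = r e6\<close> and \<open>e4 e5 = s e6\<close>.\<close>

definition normal_form_mult where
  "normal_form_mult a b c d e p q r s x y = vec6 0 0 (minor x y 1 2) (minor x y 1 3)
    (a * minor x y 2 3 + c * minor x y 1 4 + p * minor x y 2 4 + minor x y 3 4)
    (b * minor x y 2 3 + d * minor x y 1 4 + q * minor x y 2 4
      + e * minor x y 1 5 + r * minor x y 2 5 + minor x y 3 5 + s * minor x y 4 5)"

definition normal_form :: "complex \<Rightarrow> complex \<Rightarrow> complex \<Rightarrow> complex \<Rightarrow> complex \<Rightarrow> complex \<Rightarrow> complex \<Rightarrow>
    complex \<Rightarrow> complex \<Rightarrow> 6 alg_structure" where
  "normal_form a b c d e p q r s = structure_constants (normal_form_mult a b c d e p q r s)"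

lemma alg_mult_normal_form:
  "alg_mult (normal_form a b c d e p q r s) x y = normal_form_mult a b c d e p q r s x y"
  unfolding normal_form_def
  by (rule alg_mult_structure_constants; rule linearI_vec; rule vec6_eqI)
    (simp_all add: normal_form_mult_def algebra_simps)

lemma normal_form_nth:
  "normal_form a b c d e p q r s $ (i, j, k) = normal_form_mult a b c d e p q r s (axis i 1) (axis j 1) $ k"
  by (simp add: normal_form_def structure_constants_def)

lemma triangular_normal_form: "normal_form a b c d e p q r s \<in> triangular rank6"
  by (rule triangularI_6[of _ 1 0 1 0 0 0 a c p 1 0 0 b d q 0 e r 1 s])
    (simp add: alg_mult_normal_form normal_form_mult_def)

lemma A82_eq_normal_form: "A82 \<alpha> = normal_form 0 0 0 0 0 0 0 \<alpha> 1"
proof (subst vec_eq_iff, unfold split_paired_All forall_6, intro conjI)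
qed (simp_all add: A82_def anticommutative_table_def normal_form_nth normal_form_mult_def axis_6,
  simp_all add: axis_def)

section \<open>Recognising the orbit of a normal form from a basis\<close>

definition columns6 :: "complex ^ 6 \<Rightarrow> complex ^ 6 \<Rightarrow> complex ^ 6 \<Rightarrow> complex ^ 6 \<Rightarrow> complex ^ 6 \<Rightarrow>
    complex ^ 6 \<Rightarrow> complex ^ 6 ^ 6" where
  "columns6 b1 b2 b3 b4 b5 b6 =
    (\<chi> i j. vec6 (b1 $ i) (b2 $ i) (b3 $ i) (b4 $ i) (b5 $ i) (b6 $ i) $ j)"

lemma columns6_mult:
  "columns6 b1 b2 b3 b4 b5 b6 *v vec6 x1 x2 x3 x4 x5 x6 =
    x1 *s b1 + x2 *s b2 + x3 *s b3 + x4 *s b4 + x5 *s b5 + x6 *s b6"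
  by (simp add: vec_eq_iff columns6_def matrix_vector_mult_def sum_6 mult.commute)

lemma invertible_columns6:
  fixes b1 b2 b3 b4 b5 b6 :: "complex ^ 6"
  defines "g \<equiv> columns6 b1 b2 b3 b4 b5 b6"
  assumes "minor b1 b2 1 2 \<noteq> 0"
    and "b3 $ 1 = 0" "b3 $ 2 = 0" "b3 $ 3 \<noteq> 0"
    and "b4 $ 1 = 0" "b4 $ 2 = 0" "b4 $ 3 = 0" "b4 $ 4 \<noteq> 0"
    and "b5 $ 1 = 0" "b5 $ 2 = 0" "b5 $ 3 = 0" "b5 $ 4 = 0" "b5 $ 5 \<noteq> 0"
    and "b6 $ 1 = 0" "b6 $ 2 = 0" "b6 $ 3 = 0" "b6 $ 4 = 0" "b6 $ 5 = 0" "b6 $ 6 \<noteq> 0"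
  shows "invertible g"
proof (rule invertibleI)
  fix x assume "g *v x = 0"
  then have *: "(g *v x) $ i = 0" for i
    by simp
  have g: "(g *v x) $ i = x $ 1 * b1 $ i + x $ 2 * b2 $ i + x $ 3 * b3 $ i + x $ 4 * b4 $ i
      + x $ 5 * b5 $ i + x $ 6 * b6 $ i" for i
    by (simp add: g_def columns6_def matrix_vector_mult_def sum_6 mult.commute)
  have 1: "x $ 1 * b1 $ 1 + x $ 2 * b2 $ 1 = 0" "x $ 1 * b1 $ 2 + x $ 2 * b2 $ 2 = 0"
    using *[of 1] *[of 2] unfolding g by (simp_all add: assms)
  have "x $ 1 * minor b1 b2 1 2 =
      (x $ 1 * b1 $ 1 + x $ 2 * b2 $ 1) * b2 $ 2 - (x $ 1 * b1 $ 2 + x $ 2 * b2 $ 2) * b2 $ 1"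
    by (simp add: algebra_simps)
  then have "x $ 1 = 0"
    using 1 assms(2) by simp
  moreover have "x $ 2 * minor b1 b2 1 2 =
      (x $ 1 * b1 $ 2 + x $ 2 * b2 $ 2) * b1 $ 1 - (x $ 1 * b1 $ 1 + x $ 2 * b2 $ 1) * b1 $ 2"
    by (simp add: algebra_simps)
  then have "x $ 2 = 0"
    using 1 assms(2) by simp
  moreover from calculation have "x $ 3 = 0"
    using *[of 3] unfolding g by (simp add: assms)
  moreover from calculation have "x $ 4 = 0"
    using *[of 4] unfolding g by (simp add: assms)
  moreover from calculation have "x $ 5 = 0"
    using *[of 5] unfolding g by (simp add: assms)
  moreover from calculation have "x $ 6 = 0"
    using *[of 6] unfolding g by (simp add: assms)
  ultimately show "x = 0"
    by (intro vec6_eqI) auto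
qed

text \<open>The matrix with columns \<open>b1\<close> to \<open>b6\<close> carries the normal form
  to \<open>\<mu>\<close>. The vanishing pattern makes it block triangular, hence invertible; the
  products omitted from the table follow from anticommutativity.\<close>

lemma gl_orbit_normal_formI:
  fixes b1 b2 b3 b4 b5 b6 :: "complex ^ 6"
  assumes \<mu>: "anticommutative \<mu>"
    and basis: "minor b1 b2 1 2 \<noteq> 0"
      "b3 $ 1 = 0" "b3 $ 2 = 0" "b3 $ 3 \<noteq> 0"
      "b4 $ 1 = 0" "b4 $ 2 = 0" "b4 $ 3 = 0" "b4 $ 4 \<noteq> 0"
      "b5 $ 1 = 0" "b5 $ 2 = 0" "b5 $ 3 = 0" "b5 $ 4 = 0" "b5 $ 5 \<noteq> 0"
      "b6 $ 1 = 0" "b6 $ 2 = 0" "b6 $ 3 = 0" "b6 $ 4 = 0" "b6 $ 5 = 0" "b6 $ 6 \<noteq> 0"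
    and table: "alg_mult \<mu> b1 b2 = b3" "alg_mult \<mu> b1 b3 = b4" "alg_mult \<mu> b3 b4 = b5"
      "alg_mult \<mu> b3 b5 = b6" "alg_mult \<mu> b2 b3 = a *s b5 + b *s b6"
      "alg_mult \<mu> b1 b4 = c *s b5 + d *s b6" "alg_mult \<mu> b1 b5 = e *s b6"
      "alg_mult \<mu> b2 b4 = p *s b5 + q *s b6" "alg_mult \<mu> b2 b5 = r *s b6"
      "alg_mult \<mu> b4 b5 = s *s b6" "alg_mult \<mu> b1 b6 = 0" "alg_mult \<mu> b2 b6 = 0"
      "alg_mult \<mu> b3 b6 = 0" "alg_mult \<mu> b4 b6 = 0" "alg_mult \<mu> b5 b6 = 0"
  shows "\<mu> \<in> gl_orbit (normal_form a b c d e p q r s)"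
proof -
  define g where "g = columns6 b1 b2 b3 b4 b5 b6"
  have g: "invertible g"
    unfolding g_def by (rule invertible_columns6) (use basis in auto)
  note gv = columns6_mult[of b1 b2 b3 b4 b5 b6, folded g_def]
  have anti: "alg_mult \<mu> x y = - alg_mult \<mu> y x" for x y
    using \<mu> unfolding anticommutative_def by blast
  have diag: "alg_mult \<mu> x x = 0" for x
  proof -
    have "alg_mult \<mu> x x $ k = - alg_mult \<mu> x x $ k" for k
      by (metis anti vector_uminus_component)
    then show ?thesis
      by (simp add: vec_eq_iff)
  qed
  have lower: "alg_mult \<mu> b2 b1 = - alg_mult \<mu> b1 b2" "alg_mult \<mu> b3 b1 = - alg_mult \<mu> b1 b3"
    "alg_mult \<mu> b4 b1 = - alg_mult \<mu> b1 b4" "alg_mult \<mu> b5 b1 = - alg_mult \<mu> b1 b5"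
    "alg_mult \<mu> b6 b1 = - alg_mult \<mu> b1 b6" "alg_mult \<mu> b3 b2 = - alg_mult \<mu> b2 b3"
    "alg_mult \<mu> b4 b2 = - alg_mult \<mu> b2 b4" "alg_mult \<mu> b5 b2 = - alg_mult \<mu> b2 b5"
    "alg_mult \<mu> b6 b2 = - alg_mult \<mu> b2 b6" "alg_mult \<mu> b4 b3 = - alg_mult \<mu> b3 b4"
    "alg_mult \<mu> b5 b3 = - alg_mult \<mu> b3 b5" "alg_mult \<mu> b6 b3 = - alg_mult \<mu> b3 b6"
    "alg_mult \<mu> b5 b4 = - alg_mult \<mu> b4 b5" "alg_mult \<mu> b6 b4 = - alg_mult \<mu> b4 b6"
    "alg_mult \<mu> b6 b5 = - alg_mult \<mu> b5 b6"
    by (rule anti)+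
  have "\<forall>i j. alg_mult \<mu> (g *v axis i 1) (g *v axis j 1) =
      g *v alg_mult (normal_form a b c d e p q r s) (axis i 1) (axis j 1)"
    unfolding forall_6 axis_6 alg_mult_normal_form normal_form_mult_def gv
    by (simp add: gv lower table diag)
  then have "gl_action g (normal_form a b c d e p q r s) = \<mu>"
    by (intro gl_action_eqI g) blast
  then show ?thesis
    using g by (auto simp: gl_orbit_def)
qed

section \<open>The closure of the family and its invariance\<close>

definition A82_closure :: "6 alg_structure set" where
  "A82_closure = zariski closure_of (\<Union>\<alpha>. gl_orbit (A82 \<alpha>))"

lemma closedin_A82_closure: "closedin zariski A82_closure"
  by (simp add: A82_closure_def)

lemma A82_closure_gl_action:
  assumes "c \<in> A82_closure" "invertible g"
  shows "gl_action g c \<in> A82_closure"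
  unfolding A82_closure_def
proof (rule gl_action_closure[OF _ assms(2)])
  show "c \<in> zariski closure_of (\<Union>\<alpha>. gl_orbit (A82 \<alpha>))"
    using assms by (simp add: A82_closure_def)
  fix g :: "complex ^ 6 ^ 6" and c assume "invertible g" "c \<in> (\<Union>\<alpha>. gl_orbit (A82 \<alpha>))"
  moreover from this have "gl_action g c \<in> gl_orbit c"
    by (auto simp: gl_orbit_def)
  ultimately show "gl_action g c \<in> (\<Union>\<alpha>. gl_orbit (A82 \<alpha>))"
    using gl_orbit_trans by blast
qed

lemma A82_closure_gl_orbit: "d \<in> gl_orbit c \<Longrightarrow> c \<in> A82_closure \<Longrightarrow> d \<in> A82_closure"
  by (auto simp: gl_orbit_def intro: A82_closure_gl_action)

lemma gl_orbit_subset_A82_closure: "gl_orbit (A82 \<alpha>) \<subseteq> A82_closure"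
  unfolding A82_closure_def by (rule subset_trans[OF _ closure_of_subset]) auto

lemma anticommutative_normal_form: "anticommutative (normal_form a b c d e p q r s)"
  using triangular_normal_form by (auto simp: triangular_def)

section \<open>Changes of basis that remove the parameters of the normal form\<close>

lemmas normal_form_simps = alg_mult_normal_form normal_form_mult_def

text \<open>Scaling \<open>e1\<close> by \<open>l\<close> multiplies \<open>e3\<close>,
  \<open>e4\<close>, \<open>e5\<close>, \<open>e6\<close> by \<open>l\<close>, \<open>l^2\<close>,
  \<open>l^3\<close>, \<open>l^4\<close>. The coefficient of \<open>e4 e5\<close> becomes
  \<open>l * s\<close>, so \<open>l = 1 / s\<close> normalises it.\<close>

lemma normal_form_scale:
  assumes "s \<noteq> 0"
  shows "normal_form 0 0 0 0 0 0 0 r s \<in> gl_orbit (normal_form 0 0 0 0 0 0 0 (r * s) 1)"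
proof -
  define l where "l = 1 / s"
  have s: "s = 1 / l" "l \<noteq> 0"
    using assms by (simp_all add: l_def)
  show ?thesis
    unfolding s(1)
    by (rule gl_orbit_normal_formI[OF anticommutative_normal_form,
        of "vec6 l 0 0 0 0 0" "vec6 0 1 0 0 0 0" "vec6 0 0 l 0 0 0" "vec6 0 0 0 (l^2) 0 0"
          "vec6 0 0 0 0 (l^3) 0" "vec6 0 0 0 0 0 (l^4)"]; (rule vec6_eqI)?)
      (simp_all add: s(2) normal_form_simps field_simps eval_nat_numeral)
qed

text \<open>Deliberately introduces a parameter \<open>e\<close>, as the start of an exchange that
  will remove \<open>b\<close>.\<close>

lemma normal_form_shift_e1_by_e2:
  "normal_form 0 b 0 0 0 0 0 r s \<in> gl_orbit (normal_form 0 b 0 0 (x * r) 0 0 r s)"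
  by (rule gl_orbit_normal_formI[OF anticommutative_normal_form,
      of "vec6 1 x 0 0 0 0" "vec6 0 1 0 0 0 0" "vec6 0 0 1 0 0 0" "vec6 0 0 0 1 0 (x * b)"
        "vec6 0 0 0 0 1 0" "vec6 0 0 0 0 0 1"]; (rule vec6_eqI)?)
    (simp_all add: normal_form_simps)

text \<open>Adding \<open>x e4\<close> to \<open>e1\<close> changes \<open>e1 e5\<close> by
  \<open>x * s\<close>, which removes \<open>e\<close> at the expense of \<open>q\<close>.\<close>

lemma normal_form_shift_e1_by_e4:
  assumes "s \<noteq> 0"
  shows "normal_form 0 b 0 d e 0 q r s \<in> gl_orbit (normal_form 0 b 0 d 0 0 (q + e / s * r) r s)"
proof -
  define x where "x = - e / s"
  have e: "e = - x * s" "e / s = - x"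
    using assms by (simp_all add: x_def)
  show ?thesis
    unfolding e(2) unfolding e(1)
    by (rule gl_orbit_normal_formI[OF anticommutative_normal_form,
        of "vec6 1 0 0 x 0 0" "vec6 0 1 0 0 0 0" "vec6 0 0 1 0 0 (- x * q)" "vec6 0 0 0 1 (- x) 0"
          "vec6 0 0 0 0 1 (- x)" "vec6 0 0 0 0 0 1"]; (rule vec6_eqI)?)
      (simp_all add: normal_form_simps algebra_simps)
qed

text \<open>Multiples of \<open>e5\<close> added to \<open>e1\<close> and \<open>e2\<close>
  contribute to the products with \<open>e4\<close> and remove \<open>d\<close> and
  \<open>q\<close>. The product of \<open>e5\<close> with \<open>e3\<close> then shifts
  \<open>b\<close>.\<close>

lemma normal_form_shift_by_e5:
  assumes "s \<noteq> 0"
  shows "normal_form 0 b 0 d 0 0 q r s \<in> gl_orbit (normal_form 0 (b - q / s) 0 0 0 0 0 r s)"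
proof -
  define x y where "x = d / s" and "y = q / s"
  have dq: "d = x * s" "q = y * s" "q / s = y"
    using assms by (simp_all add: x_def y_def)
  show ?thesis
    unfolding dq(3) unfolding dq(1,2)
    by (rule gl_orbit_normal_formI[OF anticommutative_normal_form,
        of "vec6 1 0 0 0 x 0" "vec6 0 1 0 0 y 0" "vec6 0 0 1 0 0 (- x * r)" "vec6 0 0 0 1 0 (- x)"
          "vec6 0 0 0 0 1 0" "vec6 0 0 0 0 0 1"]; (rule vec6_eqI)?)
      (simp_all add: normal_form_simps algebra_simps)
qed

text \<open>The product of \<open>a e4\<close> with \<open>e3\<close> cancels the component of
  \<open>e2 e3\<close> at \<open>e5\<close>.\<close>

lemma normal_form_shift_e2_by_e4:
  "normal_form a b 0 d e 0 q r s \<in> gl_orbit (normal_form 0 b 0 d e 0 q (r + a * s) s)"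
  by (rule gl_orbit_normal_formI[OF anticommutative_normal_form,
      of "vec6 1 0 0 0 0 0" "vec6 0 1 0 a 0 0" "vec6 0 0 1 0 0 (a * d)" "vec6 0 0 0 1 0 0"
        "vec6 0 0 0 0 1 0" "vec6 0 0 0 0 0 1"]; (rule vec6_eqI)?)
    (simp_all add: normal_form_simps algebra_simps)

text \<open>Subtracting \<open>c e3\<close> from \<open>e1\<close> and \<open>p e3\<close> from
  \<open>e2\<close> removes the components of \<open>e1 e4\<close> and \<open>e2 e4\<close> at
  \<open>e5\<close>. The new \<open>e3\<close> contains \<open>- p e4\<close>, so the new
  \<open>e6 = e3 e5\<close> is multiplied by \<open>1 - p * s\<close>, which therefore must not
  vanish.\<close>

lemma normal_form_shift_by_e3:
  assumes "1 - p * s \<noteq> 0"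
  shows "\<exists>a' b' d' e' q' r' s'.
    normal_form a b c d e p q r s \<in> gl_orbit (normal_form a' b' 0 d' e' 0 q' r' s')"
proof -
  define u where "u = 1 - p * s"
  have u: "u \<noteq> 0" "p * s = 1 - u"
    using assms by (simp_all add: u_def)
  \<comment> \<open>\<open>B\<close> is the last coordinate of the new \<open>e2 e3\<close> after
    subtraction of \<open>a\<close> times the new \<open>e5\<close>; \<open>X\<close> is the last
    coordinate of the new \<open>e4\<close>.\<close>
  define B where "B = b - p * c * a - p * q + r * c * a + a * c * a * s"
  define X where "X = c * a * e - p * d - c * c * a"
  have "normal_form a b c d e p q r s \<in>
      gl_orbit (normal_form a (B / u) 0 (d / u) ((e - c) / u) 0 (q / u) ((r - p) / u) (s / u))"
    by (rule gl_orbit_normal_formI[OF anticommutative_normal_form,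
        of "vec6 1 0 (- c) 0 0 0" "vec6 0 1 (- p) 0 0 0" "vec6 0 0 1 (- p) (c * a) (c * b)"
          "vec6 0 0 0 1 0 X" "vec6 0 0 0 0 1 (- c * a * s)" "vec6 0 0 0 0 0 u"]; (rule vec6_eqI)?)
      (use u in \<open>simp_all add: normal_form_simps X_def B_def diff_divide_distrib
        add_divide_distrib algebra_simps\<close>)
  then show ?thesis
    by blast
qed

text \<open>Affine dependence on \<open>p\<close>, \<open>r\<close>, \<open>s\<close>, in the shape
  that \<open>line_in_zariski_closed\<close> expects. The difference of normal forms removes the
  constant entries from the direction.\<close>

lemma normal_form_line:
  "normal_form a b c d e (p + t * p') q (r + t * r') (s + t * s') = normal_form a b c d e p q r s
    + t *s (normal_form 0 0 0 0 0 p' 0 r' s' - normal_form 0 0 0 0 0 0 0 0 0)"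
  by (simp only: vec_eq_iff split_paired_All forall_6 normal_form_nth axis_6)
    (simp add: normal_form_nth axis_6 normal_form_mult_def)

text \<open>The parameter \<open>b\<close> is removed by a detour: create \<open>e\<close>, exchange
  it for \<open>q\<close>, then exchange \<open>q\<close> for a change of \<open>b\<close>.\<close>

lemma normal_form_in_A82_closure_1:
  assumes "s \<noteq> 0" "r \<noteq> 0"
  shows "normal_form 0 b 0 0 0 0 0 r s \<in> A82_closure"
proof -
  have 0: "normal_form 0 0 0 0 0 0 0 r s \<in> A82_closure"
    using normal_form_scale[OF assms(1), of r] gl_orbit_subset_A82_closure[of "r * s"]
    unfolding A82_eq_normal_form by blast
  \<comment> \<open>The detour changes \<open>b\<close> by
    \<open>- x * r * r / (s * s)\<close>.\<close>
  define x where "x = b * s * s / (r * r)"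
  have "b - (0 + x * r / s * r) / s = 0"
    using assms by (simp add: x_def field_simps)
  then have "normal_form 0 b 0 0 0 0 (0 + x * r / s * r) r s \<in> A82_closure"
    using normal_form_shift_by_e5[OF assms(1), of b 0 "0 + x * r / s * r" r] 0
      A82_closure_gl_orbit by metis
  then have "normal_form 0 b 0 0 (x * r) 0 0 r s \<in> A82_closure"
    using normal_form_shift_e1_by_e4[OF assms(1)] A82_closure_gl_orbit by blast
  then show ?thesis
    using normal_form_shift_e1_by_e2 A82_closure_gl_orbit by blast
qed

text \<open>Moving \<open>r\<close> and \<open>s\<close> along a line makes both nonzero for all but
  finitely many parameters.\<close>

lemma normal_form_in_A82_closure_2: "normal_form 0 b 0 d e 0 q r s \<in> A82_closure"
proof (rule line_in_zariski_closed[OF closedin_A82_closure])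
  show "[:r, 1:] * [:s, 1:] \<noteq> 0"
    by simp
  fix t assume "poly ([:r, 1:] * [:s, 1:]) t \<noteq> 0"
  then have t: "r + t * 1 \<noteq> 0" "s + t * 1 \<noteq> 0"
    unfolding poly_mult mult_eq_0_iff by auto
  have "normal_form 0 b 0 d e 0 q (r + t * 1) (s + t * 1) \<in> A82_closure"
    by (rule A82_closure_gl_orbit[OF normal_form_shift_e1_by_e4[OF t(2)]
          A82_closure_gl_orbit[OF normal_form_shift_by_e5[OF t(2)]
          normal_form_in_A82_closure_1[OF t(2,1)]]])
  then show "normal_form 0 b 0 d e 0 q r s
      + t *s (normal_form 0 0 0 0 0 0 0 1 1 - normal_form 0 0 0 0 0 0 0 0 0) \<in> A82_closure"
    unfolding normal_form_line [symmetric] by simp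
qed

lemma normal_form_in_A82_closure: "normal_form a b c d e p q r s \<in> A82_closure"
proof -
  have *: "normal_form a b c d e p q r s \<in> A82_closure" if u: "1 - p * s \<noteq> 0" for p
    using normal_form_shift_by_e3[OF u] A82_closure_gl_orbit[OF normal_form_shift_e2_by_e4]
      A82_closure_gl_orbit normal_form_in_A82_closure_2 by metis
  show ?thesis
  proof (cases "1 - p * s = 0")
    case False
    then show ?thesis
      by (rule *)
  next
    case True
    show ?thesis
    proof (rule line_in_zariski_closed[OF closedin_A82_closure])
      \<comment> \<open>In this case \<open>p * s = 1\<close>, so \<open>s\<close> is
        nonzero.\<close>
      show "[:1 - p * s, - s:] \<noteq> 0"
        using True by auto
      fix t assume "poly [:1 - p * s, - s:] t \<noteq> 0"
      then have "1 - (p + t * 1) * s \<noteq> 0"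
        by (simp add: algebra_simps)
      then have "normal_form a b c d e (p + t * 1) q (r + t * 0) (s + t * 0) \<in> A82_closure"
        using * by simp
      then show "normal_form a b c d e p q r s
          + t *s (normal_form 0 0 0 0 0 1 0 0 0 - normal_form 0 0 0 0 0 0 0 0 0) \<in> A82_closure"
        unfolding normal_form_line .
    qed
  qed
qed

text \<open>A basis of the normal form is generated by \<open>b1\<close> and \<open>b2\<close>. The
  four inequalities say that \<open>b3\<close>, \<open>b4\<close>, \<open>b5\<close>,
  \<open>b6\<close> have nonzero leading coordinates; the last one combines the components of
  \<open>b3\<close> at indices 3 and 4, both of which act on \<open>b5\<close>.\<close>

lemma generic_triangular_in_A82_closure:
  assumes c: "c \<in> triangular rank6"
    and ne: "c $ (1, 2, 3) \<noteq> 0" "c $ (1, 3, 4) \<noteq> 0" "c $ (3, 4, 5) \<noteq> 0"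
      "c $ (1, 2, 3) * c $ (3, 5, 6) + c $ (1, 2, 4) * c $ (4, 5, 6) \<noteq> 0"
  shows "c \<in> A82_closure"
proof -
  \<comment> \<open>Chosen so that \<open>b2 = e2 - k e1\<close> annihilates \<open>e3\<close>
    modulo \<open>e5\<close> and \<open>e6\<close>.\<close>
  define k where "k = c $ (2, 3, 4) / c $ (1, 3, 4)"
  have k: "c $ (2, 3, 4) = k * c $ (1, 3, 4)"
    using ne by (simp add: k_def)
  define m where "m = alg_mult c"
  note mult = alg_mult_triangular[OF c, folded m_def]
  define b1 where "b1 = vec6 1 0 0 0 0 0"
  define b2 where "b2 = vec6 (- k) 1 0 0 0 0"
  define b3 where "b3 = m b1 b2"
  define b4 where "b4 = m b1 b3"
  define b5 where "b5 = m b3 b4"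
  define b6 where "b6 = m b3 b5"
  have b12: "b1 $ 1 = 1" "b1 $ 2 = 0" "b1 $ 3 = 0" "b1 $ 4 = 0" "b1 $ 5 = 0" "b1 $ 6 = 0"
    "b2 $ 1 = - k" "b2 $ 2 = 1" "b2 $ 3 = 0" "b2 $ 4 = 0" "b2 $ 5 = 0" "b2 $ 6 = 0"
    by (simp_all add: b1_def b2_def)
  have b3: "b3 $ 1 = 0" "b3 $ 2 = 0" "b3 $ 3 = c $ (1, 2, 3)" "b3 $ 4 = c $ (1, 2, 4)"
    unfolding b3_def mult by (simp_all add: b12)
  have b4: "b4 $ 1 = 0" "b4 $ 2 = 0" "b4 $ 3 = 0" "b4 $ 4 = c $ (1, 3, 4) * c $ (1, 2, 3)"
    unfolding b4_def mult by (simp_all add: b12 b3)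
  have b5: "b5 $ 1 = 0" "b5 $ 2 = 0" "b5 $ 3 = 0" "b5 $ 4 = 0"
      "b5 $ 5 = c $ (3, 4, 5) * (c $ (1, 2, 3) * (c $ (1, 3, 4) * c $ (1, 2, 3)))"
    unfolding b5_def mult by (simp_all add: b3 b4)
  have b6: "b6 $ 1 = 0" "b6 $ 2 = 0" "b6 $ 3 = 0" "b6 $ 4 = 0" "b6 $ 5 = 0"
      "b6 $ 6 = (c $ (1, 2, 3) * c $ (3, 5, 6) + c $ (1, 2, 4) * c $ (4, 5, 6)) * b5 $ 5"
    unfolding b6_def mult by (simp_all add: b3 b5(1-4) algebra_simps)
  have b5_ne: "b5 $ 5 \<noteq> 0"
    using ne by (simp add: b5)
  have b6_ne: "b6 $ 6 \<noteq> 0"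
    using ne b5_ne by (simp add: b6(6))
  have span56: "\<exists>u v. w = u *s b5 + v *s b6" if "w $ 1 = 0" "w $ 2 = 0" "w $ 3 = 0" "w $ 4 = 0" for w
  proof (intro exI vec6_eqI)
    let ?u = "w $ 5 / b5 $ 5"
    let ?v = "(w $ 6 - ?u * b5 $ 6) / b6 $ 6"
    show "w $ 5 = (?u *s b5 + ?v *s b6) $ 5" "w $ 6 = (?u *s b5 + ?v *s b6) $ 6"
      using b5_ne b6_ne by (simp_all add: b6(5))
  qed (simp_all add: that b5(1-4) b6(1-4))
  have span6: "\<exists>v. w = v *s b6" if "w $ 1 = 0" "w $ 2 = 0" "w $ 3 = 0" "w $ 4 = 0" "w $ 5 = 0" for w
  proof (intro exI vec6_eqI)
    show "w $ 6 = (w $ 6 / b6 $ 6 *s b6) $ 6"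
      using b6_ne by simp
  qed (simp_all add: that b6(1-5))
  have "\<exists>a b. m b2 b3 = a *s b5 + b *s b6"
    by (rule span56) (simp_all add: mult b12 b3 k)
  then obtain a b where 1: "m b2 b3 = a *s b5 + b *s b6"
    by blast
  have "\<exists>a b. m b1 b4 = a *s b5 + b *s b6"
    by (rule span56) (simp_all add: mult b12 b4)
  then obtain c' d where 2: "m b1 b4 = c' *s b5 + d *s b6"
    by blast
  have "\<exists>e. m b1 b5 = e *s b6"
    by (rule span6) (simp_all add: mult b12 b5(1-4))
  then obtain e where 3: "m b1 b5 = e *s b6"
    by blast
  have "\<exists>a b. m b2 b4 = a *s b5 + b *s b6"
    by (rule span56) (simp_all add: mult b12 b4)
  then obtain p q where 4: "m b2 b4 = p *s b5 + q *s b6"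
    by blast
  have "\<exists>e. m b2 b5 = e *s b6"
    by (rule span6) (simp_all add: mult b12 b5(1-4))
  then obtain r where 5: "m b2 b5 = r *s b6"
    by blast
  have "\<exists>e. m b4 b5 = e *s b6"
    by (rule span6) (simp_all add: mult b4 b5(1-4))
  then obtain s where 6: "m b4 b5 = s *s b6"
    by blast
  have 7: "m b1 b6 = 0" "m b2 b6 = 0" "m b3 b6 = 0" "m b4 b6 = 0" "m b5 b6 = 0"
    by (rule vec6_eqI; simp add: mult b12 b3 b4 b5(1-4) b6(1-5))+
  have "c \<in> gl_orbit (normal_form a b c' d e p q r s)"
    by (rule gl_orbit_normal_formI[of c b1 b2 b3 b4 b5 b6])
      (use c ne b5_ne b6_ne in \<open>simp_all add: triangular_def b12 b3(1-3) b4 b5(1-4) b6(1-5)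
        1 2 3 4 5 6 7 flip: m_def b3_def b4_def b5_def b6_def\<close>)
  then show ?thesis
    using A82_closure_gl_orbit normal_form_in_A82_closure by blast
qed

lemma triangular_add_scale:
  assumes c: "c \<in> triangular r" and d: "d \<in> triangular r"
  shows "a *s c + b *s d \<in> triangular r"
proof -
  have "anticommutative (a *s c + b *s d)"
    unfolding anticommutative_iff
  proof (intro allI)
    fix i j k
    show "(a *s c + b *s d) $ (i, j, k) = - (a *s c + b *s d) $ (j, i, k)"
      using triangular_anti[OF c, of i j k] triangular_anti[OF d, of i j k] by simp
  qed
  moreover have "r i < r k \<and> r j < r k" if "(a *s c + b *s d) $ (i, j, k) \<noteq> 0" for i j k
    using that triangular_zero[OF c, of k i j] triangular_zero[OF d, of k i j] by fastforce
  ultimately show ?thesis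
    unfolding triangular_def by blast
qed

lemma triangular_subset_A82_closure: "triangular rank6 \<subseteq> A82_closure"
proof
  fix c assume c: "c \<in> triangular rank6"
  \<comment> \<open>This is \<open>A82 0\<close>. In this direction each of the four generic
    conditions becomes a monic polynomial in \<open>t\<close>, and \<open>?Q\<close> is their
    product.\<close>
  let ?d = "normal_form 0 0 0 0 0 0 0 0 1"
  have d: "?d $ (1, 2, 3) = 1" "?d $ (1, 2, 4) = 0" "?d $ (1, 3, 4) = 1" "?d $ (3, 4, 5) = 1"
    "?d $ (3, 5, 6) = 1" "?d $ (4, 5, 6) = 1"
    by (simp_all add: normal_form_nth axis_6 normal_form_mult_def)
  let ?Q = "[:c $ (1, 2, 3), 1:] * [:c $ (1, 3, 4), 1:] * [:c $ (3, 4, 5), 1:] *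
    [:c $ (1, 2, 3) * c $ (3, 5, 6) + c $ (1, 2, 4) * c $ (4, 5, 6),
      c $ (1, 2, 3) + c $ (3, 5, 6) + c $ (1, 2, 4), 1:]"
  show "c \<in> A82_closure"
  proof (rule line_in_zariski_closed[OF closedin_A82_closure])
    show "?Q \<noteq> 0"
      by simp
    fix t assume "poly ?Q t \<noteq> 0"
    then have t: "c $ (1, 2, 3) + t \<noteq> 0" "c $ (1, 3, 4) + t \<noteq> 0" "c $ (3, 4, 5) + t \<noteq> 0"
      "(c $ (1, 2, 3) + t) * (c $ (3, 5, 6) + t) + c $ (1, 2, 4) * (c $ (4, 5, 6) + t) \<noteq> 0"
      unfolding poly_mult mult_eq_0_iff by (auto simp: algebra_simps)
    have "1 *s c + t *s ?d \<in> triangular rank6"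
      by (intro triangular_add_scale c triangular_normal_form)
    then show "c + t *s ?d \<in> A82_closure"
      using t by (intro generic_triangular_in_A82_closure) (simp_all add: d)
  qed
qed

section \<open>The variety of nilpotent structures\<close>

abbreviation (input) nilpotent_variety :: "6 alg_structure set" where
  "nilpotent_variety \<equiv> nilpotent_anticommutative"

lemma nilpotent_variety_eq_translates: "nilpotent_variety = translates UNIV (triangular rank6)"
  and closedin_nilpotent_variety: "closedin zariski nilpotent_variety"
  using nilpotent_anticommutative_eq[OF bij_rank6] by simp_all

lemma A82_triangular: "A82 \<alpha> \<in> triangular rank6"
  unfolding A82_eq_normal_form by (rule triangular_normal_form)

lemma irreducible_nilpotent_variety: "irreducible_set nilpotent_variety"
  unfolding nilpotent_variety_eq_translates
  by (rule irreducible_translates[OF A82_triangular UNIV_I invertible_mat_1],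
      rule UNIV_I, rule triangular_add_scale)

lemma nilpotent_variety_eq_A82_closure: "nilpotent_variety = A82_closure"
proof
  show "nilpotent_variety \<subseteq> A82_closure"
    unfolding nilpotent_variety_eq_translates translates_def
    using triangular_subset_A82_closure by (auto intro!: A82_closure_gl_action)
  have "gl_orbit (A82 \<alpha>) \<subseteq> nilpotent_variety" for \<alpha>
    unfolding nilpotent_variety_eq_translates translates_def gl_orbit_def using A82_triangular by blast
  then show "A82_closure \<subseteq> nilpotent_variety"
    unfolding A82_closure_def by (intro closure_of_minimal closedin_nilpotent_variety) blast
qed

section \<open>Parametrisation by a slice\<close>

text \<open>Of the 37 variables, 36 are matrix entries; \<open>None\<close> stands for the parameter
  of the family.\<close>

definition slice_matrix :: "((6 \<times> 6) option \<Rightarrow> complex) \<Rightarrow> complex ^ 6 ^ 6" where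
  "slice_matrix x = (\<chi> i j. x (Some (i, j)))"

definition slice_param :: "((6 \<times> 6) option \<Rightarrow> complex) \<Rightarrow> 6 alg_structure" where
  "slice_param x = gl_action (slice_matrix x) (A82 (x None))"

definition slice_base :: "complex \<Rightarrow> (6 \<times> 6) option \<Rightarrow> complex" where
  "slice_base \<alpha> v = (if v = None then \<alpha> else if v = Some (2, 2) then 1 else 0)"

definition slice_image :: "(6 \<times> 6) option set \<Rightarrow> complex \<Rightarrow> 6 alg_structure set" where
  "slice_image V \<alpha> = {slice_param x | x. (det (slice_matrix x))\<^sup>2 \<noteq> 0 \<and>
    (\<forall>v. v \<notin> V \<longrightarrow> x v = slice_base \<alpha> v)}"

text \<open>The stabiliser acts on \<open>g\<close> from the right: it rescales column 2 and adds
  multiples of column 6 to columns 1 and 2. This allows three entries to be frozen at the values in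
  \<open>slice_base\<close>: 0, 0 and 1.\<close>

definition slice_vars :: "(6 \<times> 6) option set" where
  "slice_vars = - {Some (6, 1), Some (6, 2), Some (2, 2)}"

lemma card_slice_vars: "card slice_vars = 34" "card (slice_vars - {None}) = 33"
proof -
  have "card slice_vars = card (UNIV :: (6 \<times> 6) option set) - 3"
    unfolding slice_vars_def by (simp add: Compl_eq_Diff_UNIV card_Diff_subset)
  also have "card (UNIV :: (6 \<times> 6) option set) = 37"
    by (simp add: card_UNIV_option)
  finally show "card slice_vars = 34"
    by simp
  then show "card (slice_vars - {None}) = 33"
    by (subst card_Diff_singleton) (auto simp: slice_vars_def)
qed

lemma chain_in_slice_image:
  assumes "Z n \<subseteq> zariski closure_of slice_image V \<alpha>"
    and cl: "\<And>i. i \<le> n \<Longrightarrow> closedin zariski (Z i)"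
    and irr: "\<And>i. i \<le> n \<Longrightarrow> irreducible_set (Z i)"
    and sub: "\<And>i. i < n \<Longrightarrow> Z i \<subset> Z (Suc i)"
  shows "n \<le> card V"
proof -
  interpret R: function_ring "{f. \<exists>d. separate_degree_le V d f}"
    by (rule function_ring_separate_degree)
  have var: "(\<lambda>x. x v) \<in> {f. \<exists>d. separate_degree_le V d f}" for v
    using separate_degree_le_var[of 1 V v] by auto
  have G: "(\<lambda>x. slice_matrix x $ i $ j) \<in> {f. \<exists>d. separate_degree_le V d f}" for i j
    unfolding slice_matrix_def vec_lambda_beta by (rule var)
  \<comment> \<open>The family is an affine line with direction \<open>E\<close>, so its coordinates
    are polynomial in the parameter.\<close>
  define E where "E = normal_form 0 0 0 0 0 0 0 1 0 - normal_form 0 0 0 0 0 0 0 0 0"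
  have "A82 \<alpha> = A82 0 + \<alpha> *s E" for \<alpha>
    unfolding A82_eq_normal_form E_def
    using normal_form_line[of 0 0 0 0 0 0 \<alpha> 0 0 0 1 1 0] by simp
  then have "(\<lambda>x :: (6 \<times> 6) option \<Rightarrow> complex. A82 (x None) $ t) =
      (\<lambda>x. A82 0 $ t + x None * E $ t)" for t
    by (metis vector_add_component vector_smult_component)
  then have C: "(\<lambda>x. A82 (x None) $ t) \<in> {f. \<exists>d. separate_degree_le V d f}" for t
    using R.add[OF R.const R.mult[OF var R.const], of "A82 0 $ t" None "E $ t"] by simp
  have "\<exists>f. f \<in> polyfuns \<and> (\<forall>y\<in>Z i. f y = 0) \<and> (\<exists>y\<in>Z (Suc i). f y \<noteq> 0)" if "i < n" for i
  proof -
    obtain y where "y \<in> Z (Suc i)" "y \<notin> Z i"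
      using sub[OF \<open>i < n\<close>] by blast
    then show ?thesis
      using separate_point[of "Z i" y] cl[of i] \<open>i < n\<close> by auto
  qed
  then obtain h where h: "\<And>i. i < n \<Longrightarrow> h i \<in> polyfuns \<and> (\<forall>y\<in>Z i. h i y = 0) \<and> (\<exists>y\<in>Z (Suc i). h i y \<noteq> 0)"
    by metis
  show ?thesis
  proof (rule chain_length_le[where Z = Z and h = h and V = V and \<phi> = slice_param
        and \<delta> = "\<lambda>x. (det (slice_matrix x))\<^sup>2" and b = "slice_base \<alpha>"])
    show "finite V"
      by (rule finite)
    show "\<exists>d. separate_degree_le V d (\<lambda>x. (det (slice_matrix x))\<^sup>2)"
      using R.power[OF R.det[OF G], of 2] by simp
    show "\<exists>q. (\<exists>d. separate_degree_le V d q) \<and> (\<forall>x. (det (slice_matrix x))\<^sup>2 \<noteq> 0 \<longrightarrow>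
        slice_param x $ k * (det (slice_matrix x))\<^sup>2 = q x)" for k
      using R.gl_action_rational[OF G C, of k] unfolding slice_param_def by blast
    show "Z n \<subseteq> zariski closure_of {slice_param x | x. (det (slice_matrix x))\<^sup>2 \<noteq> 0 \<and>
        (\<forall>v. v \<notin> V \<longrightarrow> x v = slice_base \<alpha> v)}"
      using assms(1) unfolding slice_image_def .
  qed (use irr sub h in auto)
qed

text \<open>Automorphisms of every \<open>A82 \<alpha>\<close>: a torus with weights 0, 1, 1, 1, 2,
  3 on the basis, together with multiples of the annihilated vector \<open>e6\<close> added to the
  two generators.\<close>

definition stabilizer_matrix :: "complex \<Rightarrow> complex \<Rightarrow> complex \<Rightarrow> complex ^ 6 ^ 6" where
  "stabilizer_matrix t a b = columns6 (vec6 1 0 0 0 0 a) (vec6 0 t 0 0 0 b) (vec6 0 0 t 0 0 0)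
    (vec6 0 0 0 t 0 0) (vec6 0 0 0 0 (t * t) 0) (vec6 0 0 0 0 0 (t * t * t))"

lemma stabilizer_matrix:
  assumes "t \<noteq> 0"
  shows "invertible (stabilizer_matrix t a b)"
    and "gl_action (stabilizer_matrix t a b) (A82 \<alpha>) = A82 \<alpha>"
proof -
  show inv: "invertible (stabilizer_matrix t a b)"
    unfolding stabilizer_matrix_def by (rule invertible_columns6) (use assms in simp_all)
  have "\<forall>i j. alg_mult (A82 \<alpha>) (stabilizer_matrix t a b *v axis i 1) (stabilizer_matrix t a b *v axis j 1) =
      stabilizer_matrix t a b *v alg_mult (A82 \<alpha>) (axis i 1) (axis j 1)"
    unfolding forall_6 axis_6 stabilizer_matrix_def columns6_mult A82_eq_normal_form
      alg_mult_normal_form normal_form_mult_def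
    by (intro conjI; rule vec6_eqI) (simp_all add: algebra_simps)
  then show "gl_action (stabilizer_matrix t a b) (A82 \<alpha>) = A82 \<alpha>"
    by (intro gl_action_eqI[OF inv]) blast
qed

lemma generic_gl_action_in_slice_image:
  assumes g: "invertible g" and ne: "g $ 6 $ 6 \<noteq> 0" "g $ 2 $ 2 * g $ 6 $ 6 - g $ 6 $ 2 * g $ 2 $ 6 \<noteq> 0"
  shows "gl_action g (A82 \<alpha>) \<in> slice_image (slice_vars - {None}) \<alpha>"
proof -
  define D where "D = g $ 2 $ 2 * g $ 6 $ 6 - g $ 6 $ 2 * g $ 2 $ 6"
  \<comment> \<open>Solves for entries \<open>(6, 1)\<close> and \<open>(6, 2)\<close> of
    \<open>g ** \<sigma>\<close> being 0 and entry \<open>(2, 2)\<close> being 1. The determinant of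
    the equations for column 2 is \<open>D\<close>.\<close>
  define \<sigma> where "\<sigma> = stabilizer_matrix (g $ 6 $ 6 / D) (- (g $ 6 $ 1 / g $ 6 $ 6)) (- (g $ 6 $ 2 / D))"
  have D: "D \<noteq> 0"
    using ne by (simp add: D_def)
  have \<sigma>: "invertible \<sigma>" "gl_action \<sigma> (A82 \<alpha>) = A82 \<alpha>"
    unfolding \<sigma>_def using stabilizer_matrix[of "g $ 6 $ 6 / D"] ne D by auto
  define h where "h = g ** \<sigma>"
  have h: "invertible h" "gl_action h (A82 \<alpha>) = gl_action g (A82 \<alpha>)"
    unfolding h_def using g \<sigma> by (simp_all add: invertible_mult flip: gl_action_gl_action)
  have col: "h $ i $ j = (g *v (\<sigma> *v axis j 1)) $ i" for i j
    unfolding h_def by (simp add: mult_axis_nth matrix_vector_mul_assoc)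
  have col12: "\<sigma> *v axis 1 1 = vec6 1 0 0 0 0 (- (g $ 6 $ 1 / g $ 6 $ 6))"
    "\<sigma> *v axis 2 1 = vec6 0 (g $ 6 $ 6 / D) 0 0 0 (- (g $ 6 $ 2 / D))"
    unfolding \<sigma>_def stabilizer_matrix_def axis_6 columns6_mult by (simp_all add: vec_eq_iff forall_6)
  have entries: "h $ 6 $ 1 = 0" "h $ 6 $ 2 = 0"
    unfolding col col12 using ne by (simp_all add: matrix_vector_mult_def sum_6)
  have "h $ 2 $ 2 = (g $ 2 $ 2 * g $ 6 $ 6 - g $ 6 $ 2 * g $ 2 $ 6) / D"
    unfolding col col12 by (simp add: matrix_vector_mult_def sum_6 diff_divide_distrib mult.commute)
  then have "h $ 2 $ 2 = 1"
    using D by (simp add: D_def)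
  define x where "x v = (case v of None \<Rightarrow> \<alpha> | Some (i, j) \<Rightarrow> h $ i $ j)" for v
  have x: "slice_matrix x = h" "x None = \<alpha>"
    by (simp_all add: slice_matrix_def x_def vec_eq_iff)
  have "gl_action g (A82 \<alpha>) = slice_param x"
    by (simp add: slice_param_def x h)
  moreover have "(det (slice_matrix x))\<^sup>2 \<noteq> 0"
    using h(1) by (simp add: x invertible_det_nz)
  moreover have "\<forall>v. v \<notin> slice_vars - {None} \<longrightarrow> x v = slice_base \<alpha> v"
    by (auto simp: slice_vars_def x_def slice_base_def entries \<open>h $ 2 $ 2 = 1\<close>)
  ultimately show ?thesis
    unfolding slice_image_def by blast
qed

text \<open>The identity satisfies the conditions of
  \<open>generic_gl_action_in_slice_image\<close>, so almost every matrix on the line from it to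
  \<open>g\<close> does.\<close>

lemma gl_orbit_subset_slice_closure:
  "gl_orbit (A82 \<alpha>) \<subseteq> zariski closure_of slice_image (slice_vars - {None}) \<alpha>"
proof
  fix c assume "c \<in> gl_orbit (A82 \<alpha>)"
  then obtain g where g: "invertible g" "c = gl_action g (A82 \<alpha>)"
    by (auto simp: gl_orbit_def)
  define P where "P i j = [:mat 1 $ i $ j, g $ i $ j - mat 1 $ i $ j:]" for i j
  define Q where "Q = P 6 6 * (P 2 2 * P 6 6 - P 6 2 * P 2 6)"
  have P: "poly (P i j) s = matrix_line (mat 1) g s $ i $ j" for i j s
    by (simp add: P_def matrix_line_def algebra_simps)
  have "poly Q 0 \<noteq> 0"
    by (simp add: Q_def P matrix_line_ends mat_def)
  then have "Q \<noteq> 0"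
    by auto
  have "gl_action g (A82 \<alpha>) \<in> zariski closure_of slice_image (slice_vars - {None}) \<alpha>"
  proof (rule gl_curve_in_closed[OF closedin_closure_of g(1) \<open>Q \<noteq> 0\<close>])
    fix s assume "poly Q s \<noteq> 0" "invertible (matrix_line (mat 1) g s)"
    then have "gl_action (matrix_line (mat 1) g s) (A82 \<alpha>) \<in> slice_image (slice_vars - {None}) \<alpha>"
      by (intro generic_gl_action_in_slice_image) (auto simp: Q_def P)
    then show "gl_action (matrix_line (mat 1) g s) (A82 \<alpha>)
        \<in> zariski closure_of slice_image (slice_vars - {None}) \<alpha>"
      using closure_of_subset[of "slice_image (slice_vars - {None}) \<alpha>" zariski] by auto
  qed
  then show "c \<in> zariski closure_of slice_image (slice_vars - {None}) \<alpha>"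
    by (simp add: g)
qed

lemma nilpotent_variety_subset_slice_closure:
  "nilpotent_variety \<subseteq> zariski closure_of slice_image slice_vars 0"
proof -
  have "slice_image (slice_vars - {None}) \<alpha> \<subseteq> slice_image slice_vars 0" for \<alpha>
  proof
    fix c assume "c \<in> slice_image (slice_vars - {None}) \<alpha>"
    then obtain x where x: "c = slice_param x" "(det (slice_matrix x))\<^sup>2 \<noteq> 0"
      "\<forall>v. v \<notin> slice_vars - {None} \<longrightarrow> x v = slice_base \<alpha> v"
      unfolding slice_image_def by blast
    have "x v = slice_base 0 v" if "v \<notin> slice_vars" for v
    proof -
      have "v \<noteq> None"
        using that by (auto simp: slice_vars_def)
      then have "slice_base \<alpha> v = slice_base 0 v"
        by (simp only: slice_base_def if_False)
      then show ?thesis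
        using x(3) that by simp
    qed
    then show "c \<in> slice_image slice_vars 0"
      unfolding slice_image_def using x(1,2) by blast
  qed
  then have "gl_orbit (A82 \<alpha>) \<subseteq> zariski closure_of slice_image slice_vars 0" for \<alpha>
    by (rule order.trans[OF gl_orbit_subset_slice_closure closure_of_mono])
  then show ?thesis
    unfolding nilpotent_variety_eq_A82_closure A82_closure_def
    by (intro closure_of_minimal closedin_closure_of) blast
qed

section \<open>A chain of length 34\<close>

definition chain_coordinates :: "(6 \<times> 6 \<times> 6) list" where
  "chain_coordinates = [(1, 2, 3), (1, 2, 4), (1, 2, 5), (1, 2, 6), (1, 3, 4), (1, 3, 5), (1, 3, 6),
    (1, 4, 5), (1, 4, 6), (1, 5, 6), (2, 3, 4), (2, 3, 5), (2, 3, 6), (2, 4, 5), (2, 4, 6),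
    (2, 5, 6), (3, 4, 5), (3, 4, 6), (3, 5, 6), (4, 5, 6)]"

text \<open>The pair \<open>(k, j)\<close> frees the entry in row \<open>j\<close> and column
  \<open>k\<close>, which adds a multiple of \<open>e_j\<close> to the image of \<open>e_k\<close>.
  The pair \<open>(2, 1)\<close> would move nothing, as the flag matters only from rank 3 on. The
  increasing order of \<open>k\<close> is used in separating consecutive cells.\<close>

definition chain_entries :: "(6 \<times> 6) list" where
  "chain_entries = [(3, 1), (3, 2), (4, 1), (4, 2), (4, 3), (5, 1), (5, 2), (5, 3), (5, 4),
    (6, 1), (6, 2), (6, 3), (6, 4), (6, 5)]"

lemma length_chain: "length chain_coordinates = 20" "length chain_entries = 14"
  by (simp_all add: chain_coordinates_def chain_entries_def)

definition coordinate_subspace :: "nat \<Rightarrow> 6 alg_structure set" where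
  "coordinate_subspace m = {c \<in> triangular rank6. \<forall>t\<in>set (drop m chain_coordinates). c $ t = 0}"

definition unipotent_matrices :: "nat \<Rightarrow> (complex ^ 6 ^ 6) set" where
  "unipotent_matrices m = {g. \<forall>j k. g $ j $ k = (if j = k then 1 else 0) \<or>
    (k, j) \<in> set (take m chain_entries)}"

text \<open>Truncated subtraction: for \<open>m \<le> 20\<close> only the identity matrix acts.\<close>

definition chain_cell :: "nat \<Rightarrow> 6 alg_structure set" where
  "chain_cell m = translates (unipotent_matrices (m - 20)) (coordinate_subspace m)"

lemma mat_1_unipotent: "mat 1 \<in> unipotent_matrices m"
  by (simp add: unipotent_matrices_def mat_def)

lemma irreducible_chain_cell: "irreducible_set (chain_cell m)"
  unfolding chain_cell_def
proof (rule irreducible_translates[OF _ mat_1_unipotent invertible_mat_1])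
  show "0 \<in> coordinate_subspace m"
    using triangular_add_scale[OF A82_triangular A82_triangular, of 0 _ 0] by (simp add: coordinate_subspace_def)
  show "matrix_line g h s \<in> unipotent_matrices (m - 20)"
    if "g \<in> unipotent_matrices (m - 20)" "h \<in> unipotent_matrices (m - 20)" for g h s
    unfolding unipotent_matrices_def
  proof (intro CollectI allI)
    fix j k
    have "g $ j $ k = (if j = k then 1 else 0) \<or> (k, j) \<in> set (take (m - 20) chain_entries)"
      "h $ j $ k = (if j = k then 1 else 0) \<or> (k, j) \<in> set (take (m - 20) chain_entries)"
      using that unfolding unipotent_matrices_def by blast+
    then show "matrix_line g h s $ j $ k = (if j = k then 1 else 0) \<or>
        (k, j) \<in> set (take (m - 20) chain_entries)"
      by (auto simp: matrix_line_def)
  qed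
  show "(1 - s) *s c + s *s d \<in> coordinate_subspace m"
    if "c \<in> coordinate_subspace m" "d \<in> coordinate_subspace m" for c d s
    unfolding coordinate_subspace_def
    by (intro CollectI conjI ballI triangular_add_scale)
      (use that in \<open>simp_all add: coordinate_subspace_def\<close>)
qed

lemma chain_cell_mono: "chain_cell m \<subseteq> chain_cell (Suc m)"
proof -
  have "set (take (m - 20) chain_entries) \<subseteq> set (take (Suc m - 20) chain_entries)"
    by (rule set_take_subset_set_take) simp
  moreover have "set (drop (Suc m) chain_coordinates) \<subseteq> set (drop m chain_coordinates)"
    by (rule set_drop_subset_set_drop) simp
  ultimately show ?thesis
    unfolding chain_cell_def translates_def unipotent_matrices_def coordinate_subspace_def by blast
qed

lemma chain_cell_subset: "chain_cell m \<subseteq> nilpotent_variety"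
  unfolding nilpotent_variety_eq_translates chain_cell_def translates_def coordinate_subspace_def by blast

lemma separate_chain_cell_1:
  assumes "m < 20"
  shows "\<exists>f\<in>polyfuns. (\<forall>c\<in>chain_cell m. f c = 0) \<and> (\<exists>c\<in>chain_cell (Suc m). f c \<noteq> 0)"
proof -
  have cell: "chain_cell l = coordinate_subspace l" if "l \<le> 20" for l
  proof -
    have "unipotent_matrices 0 = {mat 1}"
      by (auto simp: unipotent_matrices_def vec_eq_iff mat_def)
    then show ?thesis
      using that by (auto simp: chain_cell_def translates_def gl_action_1 invertible_mat_1)
  qed
  obtain i j k where t: "chain_coordinates ! m = (i, j, k)"
    by (cases "chain_coordinates ! m")
  have mem: "(i, j, k) \<in> set chain_coordinates"
    using assms t nth_mem[of m chain_coordinates] by (simp add: length_chain)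
  have ord: "\<forall>(i, j, k)\<in>set chain_coordinates. rank6 i < rank6 j \<and> rank6 j < rank6 k"
    by (simp add: chain_coordinates_def)
  have lt: "rank6 i < rank6 j" "rank6 j < rank6 k"
    using ord mem by auto
  have Cons: "drop m chain_coordinates = (i, j, k) # drop (Suc m) chain_coordinates"
    using assms t Cons_nth_drop_Suc[of m chain_coordinates] by (simp add: length_chain)
  have "distinct chain_coordinates"
    by (simp add: chain_coordinates_def)
  then have "distinct (drop m chain_coordinates)"
    by (rule distinct_drop)
  then have notin: "(i, j, k) \<notin> set (drop (Suc m) chain_coordinates)"
    unfolding Cons by simp
  \<comment> \<open>All listed triples are increasing, so the antisymmetric partner is never among
    the constrained coordinates.\<close>
  have notin': "(j, i, k) \<notin> set (drop (Suc m) chain_coordinates)"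
    using ord lt set_drop_subset[of "Suc m" chain_coordinates] by fastforce
  define d :: "6 alg_structure" where "d = axis (i, j, k) 1 - axis (j, i, k) 1"
  have d: "d $ t = (if t = (i, j, k) then 1 else 0) - (if t = (j, i, k) then 1 else 0)" for t
    by (simp add: d_def axis_def eq_commute)
  have "anticommutative d"
    unfolding anticommutative_iff
  proof (intro allI)
    fix a b e
    have "(a, b, e) = (i, j, k) \<longleftrightarrow> (b, a, e) = (j, i, k)" "(a, b, e) = (j, i, k) \<longleftrightarrow> (b, a, e) = (i, j, k)"
      by auto
    then show "d $ (a, b, e) = - d $ (b, a, e)"
      unfolding d by (simp only: minus_diff_eq)
  qed
  moreover have "\<forall>a b c. d $ (a, b, c) \<noteq> 0 \<longrightarrow> rank6 a < rank6 c \<and> rank6 b < rank6 c"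
    using lt by (auto simp: d)
  ultimately have "d \<in> triangular rank6"
    by (simp add: triangular_def)
  moreover have "d $ t = 0" if "t \<in> set (drop (Suc m) chain_coordinates)" for t
  proof -
    have "t \<noteq> (i, j, k)" "t \<noteq> (j, i, k)"
      using that notin notin' by blast+
    then show ?thesis
      by (simp add: d)
  qed
  ultimately have "d \<in> coordinate_subspace (Suc m)"
    unfolding coordinate_subspace_def by blast
  then have "d \<in> chain_cell (Suc m)"
    using assms by (simp add: cell)
  moreover have "i \<noteq> j"
    using lt by blast
  then have "d $ (i, j, k) \<noteq> 0"
    by (simp add: d)
  moreover have "\<forall>c\<in>chain_cell m. c $ (i, j, k) = 0"
    using assms by (simp add: cell coordinate_subspace_def Cons)
  ultimately show ?thesis
    by (intro bexI[of _ "\<lambda>c. c $ (i, j, k)"] polyfuns_nth) blast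
qed

text \<open>Shows that the bound of \<open>foldr_triangular\<close> is attained: the shortest rank
  allowed for a word of this length does occur.\<close>

lemma word_in_A82:
  assumes "3 \<le> rank6 k"
  shows "\<exists>xs y. length xs + 2 = rank6 k \<and> foldr (alg_mult (A82 0)) xs y = axis k 1"
proof -
  let ?e = "\<lambda>i :: 6. axis i 1 :: complex ^ 6"
  have *: "alg_mult (A82 0) (?e 1) (?e 2) = ?e 3" "alg_mult (A82 0) (?e 1) (?e 3) = ?e 4"
    "alg_mult (A82 0) (?e 3) (?e 4) = ?e 5" "alg_mult (A82 0) (?e 3) (?e 5) = ?e 6"
    unfolding A82_eq_normal_form normal_form_simps axis_6 by simp_all
  have "k \<in> {3, 4, 5, 6}"
    using assms UNIV_6 by (auto simp: rank6_def split: if_splits)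
  then consider "k = 3" | "k = 4" | "k = 5" | "k = 6"
    by blast
  then show ?thesis
  proof cases
    case 1
    then show ?thesis
      by (intro exI[of _ "[?e 1]"] exI[of _ "?e 2"]) (simp add: *)
  next
    case 2
    then show ?thesis
      by (intro exI[of _ "[?e 1, ?e 1]"] exI[of _ "?e 2"]) (simp add: *)
  next
    case 3
    then show ?thesis
      by (intro exI[of _ "[?e 3, ?e 1, ?e 1]"] exI[of _ "?e 2"]) (simp add: *)
  next
    case 4
    then show ?thesis
      by (intro exI[of _ "[?e 3, ?e 3, ?e 1, ?e 1]"] exI[of _ "?e 2"]) (simp add: *)
  qed
qed

text \<open>
  Every product of \<open>rank6 k - 1\<close> factors lies in the image of the flag member of rank \<open>k\<close>, whose
  \<open>j\<close>-th coordinate vanishes until the matrix entry with index \<open>(k, j)\<close> is set free.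
\<close>

lemma separate_chain_cell_2:
  assumes "20 \<le> m" "m < 34"
  shows "\<exists>f\<in>polyfuns. (\<forall>c\<in>chain_cell m. f c = 0) \<and> (\<exists>c\<in>chain_cell (Suc m). f c \<noteq> 0)"
proof -
  define i where "i = m - 20"
  have i: "i < length chain_entries" "Suc m - 20 = Suc i"
    using assms by (simp_all add: i_def length_chain)
  have full: "coordinate_subspace l = triangular rank6" if "20 \<le> l" for l
    using that by (simp add: coordinate_subspace_def length_chain)
  have cell: "chain_cell m = translates (unipotent_matrices i) (triangular rank6)"
    "chain_cell (Suc m) = translates (unipotent_matrices (Suc i)) (triangular rank6)"
    unfolding chain_cell_def i(2) using assms by (simp_all add: full flip: i_def)
  obtain k j where kj: "chain_entries ! i = (k, j)"
    by (cases "chain_entries ! i")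
  have "\<forall>(k, j)\<in>set chain_entries. rank6 j < rank6 k \<and> 3 \<le> rank6 k"
    by (simp add: chain_entries_def)
  then have lt: "rank6 j < rank6 k" "3 \<le> rank6 k"
    using kj nth_mem[OF i(1)] by auto
  \<comment> \<open>Among the pairs with the same \<open>j\<close>, those freed earlier have smaller
    rank in the first component.\<close>
  have sorted: "sorted_wrt (\<lambda>(l, j') (k, j). j' = j \<longrightarrow> rank6 l < rank6 k) chain_entries"
    by (simp add: chain_entries_def)
  have earlier: "rank6 l < rank6 k" if mem: "(l, j) \<in> set (take i chain_entries)" for l
  proof -
    obtain a where "a < i" "chain_entries ! a = (l, j)"
      using mem i(1) by (auto simp: in_set_conv_nth)
    then show ?thesis
      using sorted_wrt_nth_less[OF sorted _ i(1), of a] kj by simp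
  qed
  obtain xs y where word: "length xs + 2 = rank6 k" "foldr (alg_mult (A82 0)) xs y = axis k 1"
    using word_in_A82[OF lt(2)] by blast
  \<comment> \<open>The elementary matrix that uses only the newly freed entry: it sends
    \<open>e_k\<close> to \<open>e_k + e_j\<close>.\<close>
  define g0 :: "complex ^ 6 ^ 6" where "g0 = (\<chi> a b. if a = b \<or> a = j \<and> b = k then 1 else 0)"
  have "j \<noteq> k"
    using lt by auto
  have g0_mult: "(g0 *v x) $ a = x $ a + (if a = j then x $ k else 0)" for x a
  proof -
    have "(g0 *v x) $ a = (\<Sum>b\<in>UNIV. (if b = a then x $ b else 0) + (if b = k then if a = j then x $ b else 0 else 0))"
      unfolding matrix_vector_mult_def vec_lambda_beta
      by (intro sum.cong refl) (use \<open>j \<noteq> k\<close> in \<open>auto simp: g0_def\<close>)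
    then show ?thesis
      by (simp add: sum.distrib)
  qed
  have g0: "invertible g0"
  proof (rule invertibleI)
    fix x assume "g0 *v x = 0"
    then have *: "x $ a + (if a = j then x $ k else 0) = 0" for a
      by (simp flip: g0_mult)
    then have "x $ k = 0"
      using *[of k] \<open>j \<noteq> k\<close> by simp
    then have "x $ a = 0" for a
      using *[of a] by (simp only: if_cancel add_0_right)
    then show "x = 0"
      by (simp add: vec_eq_iff)
  qed
  have "(k, j) \<in> set (take (Suc i) chain_entries)"
    using i(1) kj by (simp add: take_Suc_conv_app_nth)
  then have "g0 \<in> unipotent_matrices (Suc i)"
    unfolding unipotent_matrices_def by (auto simp: g0_def)
  then have point: "gl_action g0 (A82 0) \<in> chain_cell (Suc m)"
    unfolding cell translates_def using g0 A82_triangular by blast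
  \<comment> \<open>The word producing \<open>e_k\<close>, transported by \<open>g0\<close>: at the
    chosen point its value is coordinate \<open>j\<close> of \<open>g0 *v axis k 1\<close>.\<close>
  define f where "f c = foldr (alg_mult c) (map ((*v) g0) xs) (g0 *v y) $ j" for c
  have "map ((*v) (matrix_inv g0)) (map ((*v) g0) xs) = xs"
    by (simp add: matrix_inv_cancel g0 o_def)
  then have "f (gl_action g0 (A82 0)) = (g0 *v axis k 1) $ j"
    unfolding f_def foldr_alg_mult_gl_action[OF g0] by (simp add: matrix_inv_cancel g0 word)
  also have "\<dots> = 1"
    unfolding g0_mult using \<open>j \<noteq> k\<close> by (simp add: axis_def)
  finally have nonzero: "f (gl_action g0 (A82 0)) \<noteq> 0"
    by simp
  have zero: "f c = 0" if mem: "c \<in> chain_cell m" for c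
  proof -
    obtain g d where c: "c = gl_action g d" "g \<in> unipotent_matrices i" "invertible g" "d \<in> triangular rank6"
      using mem unfolding cell translates_def by blast
    define z where "z = foldr (alg_mult d) (map ((*v) (matrix_inv g)) (map ((*v) g0) xs)) (matrix_inv g *v (g0 *v y))"
    have "inj rank6" "1 \<le> rank6 i" for i
      using bij_rank6 by (auto simp: bij_betw_def)
    moreover have "xs \<noteq> []"
      using word(1) lt(2) by auto
    ultimately have z: "rank6 k \<le> rank6 l" if "z $ l \<noteq> 0" for l
      using foldr_triangular[OF c(4), of "map ((*v) (matrix_inv g)) (map ((*v) g0) xs)"
          "matrix_inv g *v (g0 *v y)" l] that word(1) unfolding z_def by fastforce
    \<comment> \<open>The vector \<open>z\<close> lives in ranks from that of \<open>k\<close> on,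
      while row \<open>j\<close> of \<open>g\<close> has its possibly nonzero entries in column
      \<open>j\<close> and in columns freed earlier, all of smaller rank.\<close>
    have "g $ j $ l * z $ l = 0" for l
    proof (cases "z $ l = 0")
      case False
      then have "j \<noteq> l" "(l, j) \<notin> set (take i chain_entries)"
        using z lt(1) earlier by force+
      moreover have "g $ j $ l = (if j = l then 1 else 0) \<or> (l, j) \<in> set (take i chain_entries)"
        using c(2) unfolding unipotent_matrices_def by blast
      ultimately show ?thesis
        by simp
    qed simp
    then have "(g *v z) $ j = 0"
      unfolding matrix_vector_mult_def vec_lambda_beta by (intro sum.neutral ballI)
    then show ?thesis
      unfolding f_def c(1) foldr_alg_mult_gl_action[OF c(3)] z_def .
  qed
  have "f \<in> polyfuns"
    unfolding f_def by (rule polyfuns_foldr_alg_mult)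
  then show ?thesis
    using zero nonzero point by blast
qed

definition chain_member :: "nat \<Rightarrow> 6 alg_structure set" where
  "chain_member m = zariski closure_of chain_cell m"

lemma closedin_chain_member: "closedin zariski (chain_member m)"
  by (simp add: chain_member_def)

lemma irreducible_chain_member: "irreducible_set (chain_member m)"
  unfolding chain_member_def by (intro irreducible_set_closure irreducible_chain_cell)

lemma chain_member_subset: "chain_member m \<subseteq> nilpotent_variety"
  unfolding chain_member_def by (intro closure_of_minimal chain_cell_subset closedin_nilpotent_variety)

lemma chain_member_strict_mono:
  assumes "m < 34"
  shows "chain_member m \<subset> chain_member (Suc m)"
proof -
  obtain f c where f: "f \<in> polyfuns" "\<forall>c\<in>chain_cell m. f c = 0" "c \<in> chain_cell (Suc m)" "f c \<noteq> 0"
    using separate_chain_cell_1[of m] separate_chain_cell_2[of m] assms by (cases "m < 20") auto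
  have "c \<notin> chain_member m"
    using f(1,2,4) zariski_closureD[of c "chain_cell m" f] unfolding chain_member_def by blast
  moreover have "c \<in> chain_member (Suc m)"
    using f(3) closure_of_subset[of "chain_cell (Suc m)" zariski] unfolding chain_member_def by auto
  moreover have "chain_member m \<subseteq> chain_member (Suc m)"
    unfolding chain_member_def by (intro closure_of_mono chain_cell_mono)
  ultimately show ?thesis
    by blast
qed

lemma krull_dimension_nilpotent_variety:
  "krull_dimension (subtopology zariski nilpotent_variety) = 34"
proof (rule antisym)
  show "krull_dimension (subtopology zariski nilpotent_variety) \<le> 34"
    unfolding krull_dimension_def
  proof (rule Sup_least)
    fix l :: enat
    assume "l \<in> {enat n |n. \<exists>Z. (\<forall>i\<le>n. closedin (subtopology zariski nilpotent_variety) (Z i) \<and>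
      irreducible_space (subtopology (subtopology zariski nilpotent_variety) (Z i))) \<and>
      (\<forall>i<n. Z i \<subset> Z (Suc i))}"
    then obtain n Z where l: "l = enat n"
      and cl: "\<And>i. i \<le> n \<Longrightarrow> closedin (subtopology zariski nilpotent_variety) (Z i)"
      and irr: "\<And>i. i \<le> n \<Longrightarrow> irreducible_space (subtopology (subtopology zariski nilpotent_variety) (Z i))"
      and sub: "\<And>i. i < n \<Longrightarrow> Z i \<subset> Z (Suc i)"
      by blast
    have Z: "Z i \<subseteq> nilpotent_variety" "closedin zariski (Z i)" if "i \<le> n" for i
      using closedin_subset[OF cl[OF that]] closedin_closed_subtopology[OF closedin_nilpotent_variety] cl[OF that]
      by auto
    have irr': "irreducible_set (Z i)" if "i \<le> n" for i
      using irr[OF that] Z(1)[OF that] by (simp add: subtopology_subtopology irreducible_set_iff inf.absorb2)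
    have "Z n \<subseteq> zariski closure_of slice_image slice_vars 0"
      using Z(1)[OF order.refl] nilpotent_variety_subset_slice_closure by (rule order.trans)
    then have "n \<le> card slice_vars"
      by (rule chain_in_slice_image[where Z = Z, OF _ Z(2) irr' sub])
    then show "l \<le> 34"
      by (simp add: l card_slice_vars numeral_eq_enat)
  qed
  have "irreducible_space (subtopology (subtopology zariski nilpotent_variety) (chain_member i))" for i
    using irreducible_chain_member chain_member_subset
    by (simp add: subtopology_subtopology irreducible_set_iff inf.absorb2)
  moreover have "closedin (subtopology zariski nilpotent_variety) (chain_member i)" for i
    using closedin_chain_member chain_member_subset
    by (simp add: closedin_closed_subtopology closedin_nilpotent_variety)
  ultimately have "enat 34 \<le> krull_dimension (subtopology zariski nilpotent_variety)"
    unfolding krull_dimension_def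
    by (intro Sup_upper CollectI exI[of _ 34] exI[of _ chain_member] conjI refl allI impI
        chain_member_strict_mono)
  then show "34 \<le> krull_dimension (subtopology zariski nilpotent_variety)"
    by (simp add: numeral_eq_enat)
qed

lemma not_dense_gl_orbit: "\<not> nilpotent_variety \<subseteq> zariski closure_of gl_orbit (A82 \<alpha>)"
proof
  assume "nilpotent_variety \<subseteq> zariski closure_of gl_orbit (A82 \<alpha>)"
  also have "\<dots> \<subseteq> zariski closure_of slice_image (slice_vars - {None}) \<alpha>"
    by (intro closure_of_minimal gl_orbit_subset_slice_closure closedin_closure_of)
  finally have "chain_member 34 \<subseteq> zariski closure_of slice_image (slice_vars - {None}) \<alpha>"
    using chain_member_subset by blast
  then have "34 \<le> card (slice_vars - {None})"
    by (rule chain_in_slice_image[where Z = chain_member])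
      (simp_all add: closedin_chain_member irreducible_chain_member chain_member_strict_mono)
  then show False
    by (simp add: card_slice_vars)
qed

text \<open>The bound 33 concerns only the orbits of the family, whereas \<open>c\<close> is
  arbitrary. But an open orbit meets the dense union of these orbits, so it is one of them.\<close>

lemma not_rigid: "\<not> rigid_in nilpotent_variety c"
proof
  assume "rigid_in nilpotent_variety c"
  then have c: "c \<in> nilpotent_variety" "openin (subtopology zariski nilpotent_variety) (gl_orbit c)"
    by (auto simp: rigid_in_def)
  then obtain U where U: "openin zariski U" "gl_orbit c = U \<inter> nilpotent_variety"
    by (auto simp: openin_subtopology)
  have cU: "c \<in> U"
    using gl_orbit_refl[of c] U(2) by blast
  have "closedin zariski (- U)"
    using U(1) by (simp add: closedin_def Compl_eq_Diff_UNIV Diff_Diff_Int)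
  then obtain p where p: "p \<in> polyfuns" "\<forall>y\<in>- U. p y = 0" "p c \<noteq> 0"
    using separate_point[of "- U" c] cU by blast
  have dense: "nilpotent_variety \<subseteq> zariski closure_of gl_orbit c"
    unfolding subset_iff in_zariski_closure_iff
  proof (intro allI impI ballI)
    fix d f assume d: "d \<in> nilpotent_variety" and f: "f \<in> polyfuns" "\<forall>y\<in>gl_orbit c. f y = 0"
    \<comment> \<open>On the variety, \<open>f\<close> vanishes inside \<open>U\<close>, where it
      meets the orbit, and \<open>p\<close> vanishes outside \<open>U\<close>.\<close>
    have "f x * p x = 0" if "x \<in> nilpotent_variety" for x
      using that f(2) p(2) U(2) by (cases "x \<in> U") auto
    then have "(\<forall>x\<in>nilpotent_variety. f x = 0) \<or> (\<forall>x\<in>nilpotent_variety. p x = 0)"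
      by (rule irreducible_setD[OF irreducible_nilpotent_variety f(1) p(1)])
    then show "f d = 0"
      using c(1) p(3) d by blast
  qed
  have "\<exists>\<alpha>. \<exists>d\<in>gl_orbit (A82 \<alpha>). d \<in> U"
  proof (rule ccontr)
    assume "\<not> ?thesis"
    then have "p y = 0" if "y \<in> (\<Union>\<alpha>. gl_orbit (A82 \<alpha>))" for y
      using that p(2) by blast
    moreover have "c \<in> zariski closure_of (\<Union>\<alpha>. gl_orbit (A82 \<alpha>))"
      using c(1) unfolding nilpotent_variety_eq_A82_closure A82_closure_def .
    ultimately show False
      using zariski_closureD[OF _ p(1)] p(3) by blast
  qed
  then obtain \<alpha> d where d: "d \<in> gl_orbit (A82 \<alpha>)" "d \<in> U"
    by blast
  have "d \<in> nilpotent_variety"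
    using d(1) gl_orbit_subset_A82_closure unfolding nilpotent_variety_eq_A82_closure by blast
  then have "d \<in> gl_orbit c"
    using d(2) U(2) by blast
  then have "c \<in> gl_orbit (A82 \<alpha>)"
    using gl_orbit_trans[OF d(1) gl_orbit_sym] by blast
  then have "gl_orbit c \<subseteq> gl_orbit (A82 \<alpha>)"
    using gl_orbit_trans by blast
  then have "nilpotent_variety \<subseteq> zariski closure_of gl_orbit (A82 \<alpha>)"
    using order.trans[OF dense closure_of_mono] by blast
  then show False
    using not_dense_gl_orbit by blast
qed

theorem theoremB:
  shows "irreducible_space (subtopology zariski (nilpotent_anticommutative :: 6 alg_structure set))
    \<and> krull_dimension (subtopology zariski (nilpotent_anticommutative :: 6 alg_structure set)) = 34
    \<and> (\<forall>c. \<not> rigid_in (nilpotent_anticommutative :: 6 alg_structure set) c)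
    \<and> (nilpotent_anticommutative :: 6 alg_structure set)
        = zariski closure_of (\<Union>\<alpha>. gl_orbit (A82 \<alpha>))"
  using irreducible_nilpotent_variety krull_dimension_nilpotent_variety not_rigid
    nilpotent_variety_eq_A82_closure
  by (simp add: irreducible_set_iff A82_closure_def)

end
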